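(* Let $\mathcal{H}$ be a complex Hilbert space and let $A,B\in B(\mathcal{H})$ be commuting normal operators with $\|A\|=1=\|B\|$ and $B\ge 0$. Then $A\perp_P B$ if and only if the joint spectrum $\sigma(A,B)$ is contained in the unit half-ball $$\{(\zeta,t)\in\mathbb{C}\times\mathbb{R}:\ |\zeta|^2+t^2\le 1,\ t\ge 0\}$$ and contains the hemisphere $$\{(\zeta,t)\in\mathbb{C}\times\mathbb{R}:\ |\zeta|^2+t^2=1,\ t\ge 0\}.$$
   Context: $B(\mathcal{H})$ denotes the bounded linear operators on $\mathcal{H}$ with the operator norm. For vectors $x,y$ in a complex normed space, $x\perp_P y$ (Pythagoras orthogonality) means that there exists a linear isometry $f$ from the linear span of $\{x,y\}$ into a Hilbert space such that $f(x)$ and $f(y)$ are orthogonal. Equivalently, $\|\alpha x+\beta y\|^2=|\alpha|^2\|x\|^2+|\beta|^2\|y\|^2$ for all $\alpha,\beta\in\mathbb{C}$. The (joint) spectrum of two commuting normal operators is $\sigma(A,B)=\{(\omega(A),\omega(B)):\ \omega\in\Delta\}$, where $\Delta$ is the set of all (nonzero) multiplicative linear functionals on the (commutative) C$^*$-algebra generated by $A$ and $B$. *)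

theory Defs
  imports "HOL-Analysis.Analysis"
begin

class scaleC =
  fixes scaleC :: "complex \<Rightarrow> 'a \<Rightarrow> 'a" (infixr "*\<^sub>C" 75)

class complex_normed_vector = real_normed_vector + scaleC +
  assumes scaleC_add_right: "a *\<^sub>C (x + y) = a *\<^sub>C x + a *\<^sub>C y"
    and scaleC_add_left: "(a + b) *\<^sub>C x = a *\<^sub>C x + b *\<^sub>C x"
    and scaleC_scaleC: "a *\<^sub>C b *\<^sub>C x = (a * b) *\<^sub>C x"
    and scaleR_scaleC: "r *\<^sub>R x = complex_of_real r *\<^sub>C x"
    and norm_scaleC: "norm (a *\<^sub>C x) = cmod a * norm x"

text \<open>The inner product is linear in the first argument.\<close>

class complex_inner = complex_normed_vector +
  fixes cinner :: "'a \<Rightarrow> 'a \<Rightarrow> complex"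
  assumes cinner_commute: "cinner x y = cnj (cinner y x)"
    and cinner_add_left: "cinner (x + y) z = cinner x z + cinner y z"
    and cinner_scaleC_left: "cinner (c *\<^sub>C x) y = c * cinner x y"
    and cinner_self: "cinner x x = complex_of_real ((norm x)\<^sup>2)"

class complex_hilbert = complex_inner + complete_space

global_interpretation complex_vector: vector_space "scaleC :: complex \<Rightarrow> 'a \<Rightarrow> 'a::complex_normed_vector"
proof
  show "1 *\<^sub>C x = x" for x :: 'a
    using scaleR_scaleC[of 1 x] by simp
qed (simp_all add: scaleC_add_right scaleC_add_left scaleC_scaleC)

instantiation complex :: complex_hilbert
begin
definition scaleC_complex :: "complex \<Rightarrow> complex \<Rightarrow> complex"
  where "scaleC_complex a x = a * x"
definition cinner_complex :: "complex \<Rightarrow> complex \<Rightarrow> complex"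
  where "cinner_complex x y = x * cnj y"
instance
  by standard (simp_all add: scaleC_complex_def cinner_complex_def algebra_simps
      norm_mult scaleR_conv_of_real complex_norm_square del: of_real_power)
end

instantiation prod :: (complex_normed_vector, complex_normed_vector) complex_normed_vector
begin
definition scaleC_prod :: "complex \<Rightarrow> 'a \<times> 'b \<Rightarrow> 'a \<times> 'b"
  where "scaleC_prod a x = (a *\<^sub>C fst x, a *\<^sub>C snd x)"
instance
proof
  fix a :: complex and x :: "'a \<times> 'b"
  have "norm (a *\<^sub>C x) = sqrt ((cmod a)\<^sup>2 * ((norm (fst x))\<^sup>2 + (norm (snd x))\<^sup>2))"
    by (simp add: scaleC_prod_def norm_prod_def norm_scaleC power_mult_distrib distrib_left)
  then show "norm (a *\<^sub>C x) = cmod a * norm x"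
    by (simp add: real_sqrt_mult norm_prod_def)
qed (simp_all add: scaleC_prod_def scaleC_add_right scaleC_add_left scaleC_scaleC scaleR_scaleC
       prod_eq_iff)
end

instantiation prod :: (complex_inner, complex_inner) complex_inner
begin
definition cinner_prod :: "'a \<times> 'b \<Rightarrow> 'a \<times> 'b \<Rightarrow> complex"
  where "cinner_prod x y = cinner (fst x) (fst y) + cinner (snd x) (snd y)"
instance
proof
  fix x y :: "'a \<times> 'b"
  show "cinner x y = cnj (cinner y x)"
    unfolding cinner_prod_def complex_cnj_add by (metis cinner_commute)
qed (simp_all add: cinner_prod_def scaleC_prod_def cinner_add_left cinner_scaleC_left
       cinner_self norm_prod_def algebra_simps del: of_real_power)
end

instance prod :: (complex_hilbert, complex_hilbert) complex_hilbert ..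

instantiation blinfun :: (real_normed_vector, complex_normed_vector) complex_normed_vector
begin
lift_definition scaleC_blinfun :: "complex \<Rightarrow> 'a \<Rightarrow>\<^sub>L 'b \<Rightarrow> 'a \<Rightarrow>\<^sub>L 'b"
  is "\<lambda>c f x. c *\<^sub>C f x"
proof -
  fix c :: complex and f :: "'a \<Rightarrow> 'b"
  assume "bounded_linear f"
  then interpret f: bounded_linear f .
  obtain K where K: "\<And>x. norm (f x) \<le> norm x * K" using f.bounded by blast
  show "bounded_linear (\<lambda>x. c *\<^sub>C f x)"
  proof (rule bounded_linear_intro[where K = "cmod c * K"])
    show "norm (c *\<^sub>C f x) \<le> norm x * (cmod c * K)" for x
      using mult_left_mono[OF K[of x], of "cmod c"] by (simp add: norm_scaleC mult_ac)
  qed (simp_all add: f.add f.scaleR scaleC_add_right scaleR_scaleC scaleC_scaleC mult.commute)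
qed
instance
proof
  fix c :: complex and f :: "'a \<Rightarrow>\<^sub>L 'b"
  have le: "norm (c *\<^sub>C f) \<le> cmod c * norm f" for c and f :: "'a \<Rightarrow>\<^sub>L 'b"
  proof (rule norm_blinfun_bound)
    show "norm (blinfun_apply (c *\<^sub>C f) x) \<le> cmod c * norm f * norm x" for x
      using mult_left_mono[OF norm_blinfun[of f x], of "cmod c"]
      by (simp add: scaleC_blinfun.rep_eq norm_scaleC mult_ac)
  qed simp
  have "cmod c * norm f \<le> norm (c *\<^sub>C f)"
  proof (cases "c = 0")
    case False
    have "f = inverse c *\<^sub>C c *\<^sub>C f"
      using False by (intro blinfun_eqI) (simp add: scaleC_blinfun.rep_eq)
    then have "norm f \<le> inverse (cmod c) * norm (c *\<^sub>C f)"
      using le[of "inverse c" "c *\<^sub>C f"] by (simp add: norm_inverse)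
    then show ?thesis using False by (simp add: field_simps)
  qed simp
  with le[of c f] show "norm (c *\<^sub>C f) = cmod c * norm f" by simp
qed (auto intro!: blinfun_eqI simp: scaleC_blinfun.rep_eq plus_blinfun.rep_eq scaleR_blinfun.rep_eq
       scaleC_add_right scaleC_add_left scaleC_scaleC scaleR_scaleC)
end


text \<open>Type \<open>'a \<Rightarrow>\<^sub>L 'a\<close> consists of the bounded real-linear operators; its norm is the operator
  norm, so \<open>B(H)\<close> with its norm is the following subset.\<close>

definition bounded_ops :: "('a::complex_normed_vector \<Rightarrow>\<^sub>L 'a) set" where
  "bounded_ops = {A. \<forall>c x. blinfun_apply A (c *\<^sub>C x) = c *\<^sub>C blinfun_apply A x}"

text \<open>For \<open>A\<close> in \<open>B(H)\<close> the operator below exists by the Riesz representation theorem; for other real-linear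
  operators \<open>adj\<close> is a junk value.\<close>

definition adj :: "('a::complex_hilbert \<Rightarrow>\<^sub>L 'a) \<Rightarrow> ('a \<Rightarrow>\<^sub>L 'a)" where
  "adj A = (THE A'. \<forall>x y. cinner (blinfun_apply A x) y = cinner x (blinfun_apply A' y))"

definition normal_op :: "('a::complex_hilbert \<Rightarrow>\<^sub>L 'a) \<Rightarrow> bool" where
  "normal_op A \<longleftrightarrow> A o\<^sub>L adj A = adj A o\<^sub>L A"

definition positive_op :: "('a::complex_hilbert \<Rightarrow>\<^sub>L 'a) \<Rightarrow> bool" where
  "positive_op A \<longleftrightarrow> (\<forall>x. cinner (blinfun_apply A x) x \<in> \<real>\<^sub>\<ge>\<^sub>0)"


abbreviation cspan :: "'a::complex_normed_vector set \<Rightarrow> 'a set" where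
  "cspan \<equiv> module.span scaleC"

definition clinear_isometry_on ::
    "'a::complex_normed_vector set \<Rightarrow> ('a \<Rightarrow> 'b::complex_normed_vector) \<Rightarrow> bool" where
  "clinear_isometry_on S f \<longleftrightarrow>
     (\<forall>u\<in>S. \<forall>v\<in>S. f (u + v) = f u + f v) \<and>
     (\<forall>c. \<forall>u\<in>S. f (c *\<^sub>C u) = c *\<^sub>C f u) \<and>
     (\<forall>u\<in>S. norm (f u) = norm u)"

text \<open>Since a definition cannot quantify over types, the target Hilbert space is fixed to be
  \<open>\<complex>\<^sup>2\<close>. This loses nothing, as the image of the span has dimension at most two; see
  \<open>pythagoras_orthogonalI\<close> below, where the target space is arbitrary.\<close>

definition pythagoras_orthogonal :: "'a::complex_normed_vector \<Rightarrow> 'a \<Rightarrow> bool" (infix "\<bottom>\<^sub>P" 50) where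
  "x \<bottom>\<^sub>P y \<longleftrightarrow>
     (\<exists>f :: 'a \<Rightarrow> complex \<times> complex. clinear_isometry_on (cspan {x, y}) f \<and> cinner (f x) (f y) = 0)"

lemma cspan_pair: "cspan {x, y} = {a *\<^sub>C x + b *\<^sub>C y |a b. True}"
  for x y :: "'a::complex_normed_vector"
proof -
  have "cspan {x, y} = {z. \<exists>a b. z - a *\<^sub>C x = b *\<^sub>C y}"
    by (auto simp: complex_vector.span_insert complex_vector.span_singleton)
  then show ?thesis by (auto simp: algebra_simps)
qed

lemma pythagoras_identity:
  fixes f :: "'a::complex_normed_vector \<Rightarrow> 'h::complex_inner"
  assumes f: "clinear_isometry_on (cspan {x, y}) f" and orth: "cinner (f x) (f y) = 0"
  shows "(norm (a *\<^sub>C x + b *\<^sub>C y))\<^sup>2 = (cmod a)\<^sup>2 * (norm x)\<^sup>2 + (cmod b)\<^sup>2 * (norm y)\<^sup>2"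
proof -
  have [simp]: "x \<in> cspan {x, y}" "y \<in> cspan {x, y}"
    by (auto intro: complex_vector.span_base)
  have sc: "c *\<^sub>C u \<in> cspan {x, y}" if "u \<in> cspan {x, y}" for c u
    using that by (rule complex_vector.span_scale)
  have ab: "a *\<^sub>C x + b *\<^sub>C y \<in> cspan {x, y}"
    by (intro complex_vector.span_add sc) auto
  let ?u = "a *\<^sub>C f x" and ?v = "b *\<^sub>C f y"
  have eq: "f (a *\<^sub>C x + b *\<^sub>C y) = ?u + ?v"
    using f sc[of x a] sc[of y b] by (simp add: clinear_isometry_on_def)
  have c1: "cinner p (c *\<^sub>C q) = cnj c * cinner p q" for p q :: 'h and c
    by (metis cinner_commute cinner_scaleC_left complex_cnj_mult)
  have c2: "cinner p (q + r) = cinner p q + cinner p r" for p q r :: 'h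
    by (metis cinner_commute cinner_add_left complex_cnj_add)
  have "cinner (f y) (f x) = 0" using orth cinner_commute[of "f y" "f x"] by simp
  then have "cinner (?u + ?v) (?u + ?v) = cinner ?u ?u + cinner ?v ?v"
    by (simp add: cinner_add_left cinner_scaleC_left c1 c2 orth)
  then have "complex_of_real ((norm (?u + ?v))\<^sup>2) = complex_of_real ((norm ?u)\<^sup>2 + (norm ?v)\<^sup>2)"
    by (simp only: cinner_self of_real_add)
  then have "(norm (?u + ?v))\<^sup>2 = (norm ?u)\<^sup>2 + (norm ?v)\<^sup>2"
    by (simp only: of_real_eq_iff)
  moreover have "norm (f u) = norm u" if "u \<in> cspan {x, y}" for u
    using f that by (simp add: clinear_isometry_on_def)
  ultimately show ?thesis
    using ab by (simp add: norm_scaleC power_mult_distrib flip: eq)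
qed

lemma pythagoras_orthogonal_iff:
  "x \<bottom>\<^sub>P y \<longleftrightarrow>
     (\<forall>a b. (norm (a *\<^sub>C x + b *\<^sub>C y))\<^sup>2 = (cmod a)\<^sup>2 * (norm x)\<^sup>2 + (cmod b)\<^sup>2 * (norm y)\<^sup>2)"
  (is "_ \<longleftrightarrow> ?P") for x y :: "'a::complex_normed_vector"
proof
  assume "x \<bottom>\<^sub>P y"
  then show ?P unfolding pythagoras_orthogonal_def using pythagoras_identity by blast
next
  assume P: ?P
  define g :: "complex \<Rightarrow> complex \<Rightarrow> complex \<times> complex"
    where "g a b = (a * of_real (norm x), b * of_real (norm y))" for a b
  have "\<forall>u\<in>cspan {x, y}. \<exists>a b. u = a *\<^sub>C x + b *\<^sub>C y"
    unfolding cspan_pair by blast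
  then obtain a b where ab: "u = a u *\<^sub>C x + b u *\<^sub>C y" if "u \<in> cspan {x, y}" for u
    by metis
  define f where "f u = g (a u) (b u)" for u
  have uniq: "g p q = g p' q'" if "p *\<^sub>C x + q *\<^sub>C y = p' *\<^sub>C x + q' *\<^sub>C y" for p q p' q'
  proof -
    have "(p - p') *\<^sub>C x + (q - q') *\<^sub>C y = 0"
      using that by (simp add: complex_vector.scale_left_diff_distrib algebra_simps)
    then have "(cmod (p - p'))\<^sup>2 * (norm x)\<^sup>2 + (cmod (q - q'))\<^sup>2 * (norm y)\<^sup>2 = 0"
      using P[rule_format, of "p - p'" "q - q'"] by simp
    then show ?thesis
      by (auto simp: g_def sum_power2_eq_zero_iff simp flip: power_mult_distrib)
  qed
  have f: "f (p *\<^sub>C x + q *\<^sub>C y) = g p q" for p q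
    unfolding f_def by (rule uniq, rule ab[symmetric]) (auto simp: cspan_pair)
  have "clinear_isometry_on (cspan {x, y}) f"
    unfolding clinear_isometry_on_def cspan_pair
  proof (safe)
    fix p q r s :: complex
    have "f ((p *\<^sub>C x + q *\<^sub>C y) + (r *\<^sub>C x + s *\<^sub>C y)) = f ((p + r) *\<^sub>C x + (q + s) *\<^sub>C y)"
      by (simp add: scaleC_add_left algebra_simps)
    then show "f ((p *\<^sub>C x + q *\<^sub>C y) + (r *\<^sub>C x + s *\<^sub>C y))
        = f (p *\<^sub>C x + q *\<^sub>C y) + f (r *\<^sub>C x + s *\<^sub>C y)"
      unfolding f by (simp add: g_def algebra_simps)
  next
    fix c p q :: complex
    have "f (c *\<^sub>C (p *\<^sub>C x + q *\<^sub>C y)) = f ((c * p) *\<^sub>C x + (c * q) *\<^sub>C y)"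
      by (simp add: scaleC_add_right scaleC_scaleC)
    then show "f (c *\<^sub>C (p *\<^sub>C x + q *\<^sub>C y)) = c *\<^sub>C f (p *\<^sub>C x + q *\<^sub>C y)"
      unfolding f by (simp add: g_def scaleC_prod_def scaleC_complex_def)
  next
    fix p q :: complex
    have "(norm (g p q))\<^sup>2 = (norm (p *\<^sub>C x + q *\<^sub>C y))\<^sup>2"
      using P by (simp add: g_def norm_prod_def norm_mult power_mult_distrib)
    then show "norm (f (p *\<^sub>C x + q *\<^sub>C y)) = norm (p *\<^sub>C x + q *\<^sub>C y)"
      unfolding f by simp
  qed
  moreover have "cinner (f x) (f y) = 0"
    using f[of 1 0] f[of 0 1] by (simp add: g_def cinner_prod_def cinner_complex_def)
  ultimately show "x \<bottom>\<^sub>P y"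
    unfolding pythagoras_orthogonal_def by blast
qed

lemma pythagoras_orthogonalI:
  fixes f :: "'a::complex_normed_vector \<Rightarrow> 'h::complex_hilbert"
  assumes "clinear_isometry_on (cspan {x, y}) f" and "cinner (f x) (f y) = 0"
  shows "x \<bottom>\<^sub>P y"
  unfolding pythagoras_orthogonal_iff using pythagoras_identity[OF assms] by blast


definition cstar_subalgebra :: "('a::complex_hilbert \<Rightarrow>\<^sub>L 'a) set \<Rightarrow> bool" where
  "cstar_subalgebra S \<longleftrightarrow>
     S \<subseteq> bounded_ops \<and> closed S \<and> 0 \<in> S \<and>
     (\<forall>X\<in>S. \<forall>Y\<in>S. X + Y \<in> S \<and> X o\<^sub>L Y \<in> S) \<and>
     (\<forall>c. \<forall>X\<in>S. c *\<^sub>C X \<in> S) \<and>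
     (\<forall>X\<in>S. adj X \<in> S)"

text \<open>The generated algebra is not required to contain the identity operator. Adjoining it could
  only add the point \<open>(0, 0)\<close> to the joint spectrum.\<close>

definition generated_cstar_algebra ::
    "('a::complex_hilbert \<Rightarrow>\<^sub>L 'a) set \<Rightarrow> ('a \<Rightarrow>\<^sub>L 'a) set" where
  "generated_cstar_algebra G = cstar_subalgebra hull G"

text \<open>Values outside \<open>S\<close> are unconstrained.\<close>

definition characters_on ::
    "('a::complex_hilbert \<Rightarrow>\<^sub>L 'a) set \<Rightarrow> (('a \<Rightarrow>\<^sub>L 'a) \<Rightarrow> complex) set" where
  "characters_on S = {\<omega>.
     (\<forall>X\<in>S. \<forall>Y\<in>S. \<omega> (X + Y) = \<omega> X + \<omega> Y) \<and>
     (\<forall>c. \<forall>X\<in>S. \<omega> (c *\<^sub>C X) = c * \<omega> X) \<and>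
     (\<forall>X\<in>S. \<forall>Y\<in>S. \<omega> (X o\<^sub>L Y) = \<omega> X * \<omega> Y) \<and>
     (\<exists>X\<in>S. \<omega> X \<noteq> 0)}"

definition joint_spectrum ::
    "('a::complex_hilbert \<Rightarrow>\<^sub>L 'a) \<Rightarrow> ('a \<Rightarrow>\<^sub>L 'a) \<Rightarrow> (complex \<times> complex) set" where
  "joint_spectrum A B = {(\<omega> A, \<omega> B) |\<omega>. \<omega> \<in> characters_on (generated_cstar_algebra {A, B})}"

definition half_ball :: "(complex \<times> complex) set" where
  "half_ball = {(\<zeta>, complex_of_real t) |\<zeta> t. (cmod \<zeta>)\<^sup>2 + t\<^sup>2 \<le> 1 \<and> t \<ge> 0}"

definition hemisphere :: "(complex \<times> complex) set" where
  "hemisphere = {(\<zeta>, complex_of_real t) |\<zeta> t. (cmod \<zeta>)\<^sup>2 + t\<^sup>2 = 1 \<and> t \<ge> 0}"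

end

theory Submission
  imports Defs
begin

text \<open>
  A joint approximate eigenvector of \<open>A\<close>, \<open>A\<^sup>*\<close>, \<open>B\<close> with eigenvalues \<open>\<zeta>\<close>, \<open>cnj \<zeta>\<close>, \<open>t\<close>, not all zero,
  defines a character with values \<open>(\<zeta>, t)\<close>, since the operators \<open>X\<close> for which it is an approximate
  eigenvector of \<open>X\<close> and \<open>X\<^sup>*\<close> form a C*-algebra. For every \<open>N = a A + b B\<close> such a vector exists with
  \<open>\<bar>a \<zeta> + b t\<bar> = \<parallel>N\<parallel>\<close>: start with the approximate kernel of \<open>N\<^sup>* N - \<parallel>N\<parallel>\<^sup>2\<close> and diagonalise the commuting
  symmetric operators \<open>A + A\<^sup>*\<close>, \<open>\<i> (A - A\<^sup>*)\<close>, \<open>B\<close> on it one after the other. Conversely, characters are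
  contractive and nonnegative on positive operators. Hence \<open>\<parallel>a A + b B\<parallel>\<close>, if nonzero, is the maximum
  of \<open>\<bar>a \<zeta> + b t\<bar>\<close> over the joint spectrum.

  If \<open>A\<close> and \<open>B\<close> are Pythagoras orthogonal, then taking \<open>(a, b)\<close> to be the conjugate of a point of the
  open hemisphere, the equality case of the Cauchy-Schwarz inequality shows that the maximum is
  attained at that point; the boundary circle \<open>t = 0\<close> follows because joint approximate eigenvalues
  form a closed set.
\<close>

section \<open>Complex Hilbert spaces and adjoints\<close>

instance complex_hilbert \<subseteq> banach ..

lemma cinner_scaleC_right: "cinner x (c *\<^sub>C y) = cnj c * cinner x y"
  by (metis cinner_commute cinner_scaleC_left complex_cnj_mult)

lemma cinner_add_right: "cinner x (y + z) = cinner x y + cinner x z"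
  by (metis cinner_commute cinner_add_left complex_cnj_add)

lemma cinner_minus_left: "cinner (- x) y = - cinner x y"
  using cinner_scaleC_left[of "-1" x y] by simp

lemma cinner_minus_right: "cinner x (- y) = - cinner x y"
  using cinner_scaleC_right[of x "-1" y] by simp

lemma cinner_diff_left: "cinner (x - y) z = cinner x z - cinner y z"
  using cinner_add_left[of x "- y" z] by (simp add: cinner_minus_left)

lemma cinner_diff_right: "cinner x (y - z) = cinner x y - cinner x z"
  using cinner_add_right[of x y "- z"] by (simp add: cinner_minus_right)

lemma cinner_zero_left [simp]: "cinner 0 x = 0"
  using cinner_diff_left[of 0 0 x] by simp

lemma cinner_zero_right [simp]: "cinner x 0 = 0"
  using cinner_diff_right[of x 0 0] by simp

lemmas cinner_simps = cinner_add_left cinner_add_right cinner_diff_left cinner_diff_right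
  cinner_scaleC_left cinner_scaleC_right

lemma norm_sq_cinner: "(norm x)\<^sup>2 = Re (cinner x x)"
  by (simp add: cinner_self)

lemma Re_cinner_commute: "Re (cinner x y) = Re (cinner y x)"
  by (subst cinner_commute) simp

lemma norm_add_sq: "(norm (x + y))\<^sup>2 = (norm x)\<^sup>2 + 2 * Re (cinner x y) + (norm y)\<^sup>2"
  unfolding norm_sq_cinner by (simp add: cinner_simps Re_cinner_commute[of y x])

lemma norm_diff_sq: "(norm (x - y))\<^sup>2 = (norm x)\<^sup>2 - 2 * Re (cinner x y) + (norm y)\<^sup>2"
  unfolding norm_sq_cinner by (simp add: cinner_simps Re_cinner_commute[of y x])

text \<open>For a unit vector \<open>y\<close> the factor is -1, and this is Pythagoras for the part
  of \<open>x\<close> orthogonal to \<open>y\<close>. It yields the Cauchy-Schwarz inequality and,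
  later, the analysis of its equality case.\<close>

lemma norm_diff_projection_sq:
  "(norm (x - cinner x y *\<^sub>C y))\<^sup>2 = (norm x)\<^sup>2 + ((norm y)\<^sup>2 - 2) * (cmod (cinner x y))\<^sup>2"
proof -
  have "Re (cinner x (cinner x y *\<^sub>C y)) = (cmod (cinner x y))\<^sup>2"
    by (simp add: cinner_scaleC_right mult.commute flip: complex_norm_square)
  then show ?thesis
    by (simp add: norm_diff_sq norm_scaleC power_mult_distrib algebra_simps)
qed

lemma cmod_cinner_le: "cmod (cinner x y) \<le> norm x * norm y"
proof (cases "y = 0")
  case False
  define u where "u = complex_of_real (inverse (norm y)) *\<^sub>C y"
  have u: "norm u = 1" using False by (simp add: u_def norm_scaleC norm_inverse)
  have "0 \<le> (norm (x - cinner x u *\<^sub>C u))\<^sup>2" by simp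
  then have "(cmod (cinner x u))\<^sup>2 \<le> (norm x)\<^sup>2"
    unfolding norm_diff_projection_sq u by simp
  then have "cmod (cinner x u) \<le> norm x"
    by (rule power2_le_imp_le) simp
  moreover have "cmod (cinner x u) = cmod (cinner x y) / norm y"
    by (simp add: u_def cinner_scaleC_right norm_mult norm_inverse divide_inverse)
  ultimately show ?thesis using False by (simp add: field_simps)
qed simp

section \<open>Riesz representation: uniqueness and existence of the representing vector\<close>

lemma cinner_ext: "(\<And>x. cinner x y = cinner x z) \<Longrightarrow> y = z"
proof -
  assume "\<And>x. cinner x y = cinner x z"
  then have "cinner (y - z) (y - z) = 0" by (simp only: cinner_diff_right) simp
  then show "y = z" by (simp add: cinner_self)
qed

text \<open>Removing the projection of \<open>x\<close> onto the line through \<open>z\<close> would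
  strictly shorten \<open>x\<close> unless that projection is zero.\<close>

lemma orthogonal_if_norm_minimal:
  assumes min: "\<And>c. norm x \<le> norm (x + c *\<^sub>C z)"
  shows "cinner x z = 0"
proof (cases "z = 0")
  case False
  define u where "u = complex_of_real (inverse (norm z)) *\<^sub>C z"
  have u: "norm u = 1" using False by (simp add: u_def norm_scaleC norm_inverse)
  have "x - cinner x u *\<^sub>C u = x + (- cinner x u * complex_of_real (inverse (norm z))) *\<^sub>C z"
    by (simp add: u_def scaleC_scaleC)
  then have "norm x \<le> norm (x - cinner x u *\<^sub>C u)" using min by metis
  then have "(norm x)\<^sup>2 \<le> (norm (x - cinner x u *\<^sub>C u))\<^sup>2" by simp
  then have "cinner x u = 0" unfolding norm_diff_projection_sq u by simp
  then show ?thesis using False by (simp add: u_def cinner_scaleC_right)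
qed simp

text \<open>The representing vector is a multiple of the shortest vector \<open>a\<close> of the
  affine hyperplane where \<open>f\<close> equals 1. Moving \<open>a\<close> along the kernel of
  \<open>f\<close> stays in that hyperplane, so by minimality \<open>a\<close> is orthogonal to the
  kernel.\<close>

lemma riesz_representation:
  fixes f :: "'a::complex_hilbert \<Rightarrow> complex"
  assumes add: "\<And>x y. f (x + y) = f x + f y"
    and scale: "\<And>c x. f (c *\<^sub>C x) = c * f x"
    and bound: "\<And>x. cmod (f x) \<le> K * norm x"
  shows "\<exists>y. \<forall>x. f x = cinner x y"
proof (cases "\<forall>x. f x = 0")
  case True
  then show ?thesis by (intro exI[of _ 0]) simp
next
  case False
  then obtain w where "f w \<noteq> 0" by blast
  define S where "S = {x. f x = 1}"
  define d where "d = (INF x\<in>S. norm x)"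
  have "inverse (f w) *\<^sub>C w \<in> S" using \<open>f w \<noteq> 0\<close> by (simp add: S_def scale)
  then have ne: "norm ` S \<noteq> {}" by blast
  have bdd: "bdd_below (norm ` S)" by (intro bdd_belowI2[of _ 0]) simp
  have d_le: "d \<le> norm x" if "x \<in> S" for x
    unfolding d_def using that bdd by (intro cINF_lower)
  have d0: "0 \<le> d" unfolding d_def using ne by (intro cINF_greatest) auto
  have "\<exists>x\<in>S. norm x < d + inverse (real (Suc n))" for n
  proof -
    have "Inf (norm ` S) < d + inverse (real (Suc n))" by (simp add: d_def)
    from cInf_lessD[OF ne this] show ?thesis by blast
  qed
  then obtain x where xS: "\<And>n. x n \<in> S" and xd: "\<And>n. norm (x n) < d + inverse (real (Suc n))"
    by metis
  have diff: "f (x - y) = f x - f y" for x y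
    using add[of "x - y" y] by simp
  have scaleR: "f (r *\<^sub>R x) = of_real r * f x" for r x
    by (simp add: scaleR_scaleC scale)
  have lim: "(\<lambda>n. norm (x n)) \<longlonglongrightarrow> d"
  proof (rule tendsto_sandwich[OF _ _ tendsto_const])
    show "(\<lambda>n. d + inverse (real (Suc n))) \<longlonglongrightarrow> d"
      using tendsto_add[OF tendsto_const LIMSEQ_inverse_real_of_nat, of d] by simp
  qed (use d_le[OF xS] xd in \<open>auto intro: always_eventually less_imp_le\<close>)
  \<comment> \<open>Parallelogram law: the midpoint of two points of \<open>S\<close> lies in
    \<open>S\<close>, so its norm is at least \<open>d\<close>. Hence a minimising sequence is
    Cauchy.\<close>
  have par: "(norm (x m - x n))\<^sup>2 \<le> 2 * (norm (x m))\<^sup>2 + 2 * (norm (x n))\<^sup>2 - 4 * d\<^sup>2" for m n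
  proof -
    have "(1/2) *\<^sub>R (x m + x n) \<in> S"
      using xS[of m] xS[of n] by (simp add: S_def scaleR add)
    from d_le[OF this] have "2 * d \<le> norm (x m + x n)" by simp
    then have "(2 * d)\<^sup>2 \<le> (norm (x m + x n))\<^sup>2" using d0 by (intro power_mono) auto
    then show ?thesis by (simp add: norm_diff_sq norm_add_sq power_mult_distrib)
  qed
  have "Cauchy x"
  proof (rule CauchyI)
    fix e :: real assume "e > 0"
    have "(\<lambda>n. 4 * ((norm (x n))\<^sup>2 - d\<^sup>2)) \<longlonglongrightarrow> 4 * (d\<^sup>2 - d\<^sup>2)"
      by (intro tendsto_intros lim)
    then have "(\<lambda>n. 4 * ((norm (x n))\<^sup>2 - d\<^sup>2)) \<longlonglongrightarrow> 0" by simp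
    from order_tendstoD(2)[OF this, of "e\<^sup>2"] \<open>e > 0\<close>
    obtain M where M: "\<And>n. n \<ge> M \<Longrightarrow> 4 * ((norm (x n))\<^sup>2 - d\<^sup>2) < e\<^sup>2"
      by (auto simp: eventually_sequentially)
    show "\<exists>M. \<forall>m\<ge>M. \<forall>n\<ge>M. norm (x m - x n) < e"
    proof (intro exI allI impI)
      fix m n assume "M \<le> m" "M \<le> n"
      have "p < r" if "p \<le> 2 * a + 2 * b - 4 * c" "4 * (a - c) < r" "4 * (b - c) < r"
        for p a b c r :: real using that by simp
      from this[OF par M[OF \<open>M \<le> m\<close>] M[OF \<open>M \<le> n\<close>]]
      have "(norm (x m - x n))\<^sup>2 < e\<^sup>2" .
      then show "norm (x m - x n) < e" by (rule power2_less_imp_less) (use \<open>e > 0\<close> in simp)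
    qed
  qed
  then obtain a where a: "x \<longlonglongrightarrow> a" using Cauchy_convergent convergent_def by blast
  have na: "norm a = d" using LIMSEQ_unique[OF tendsto_norm[OF a] lim] .
  have "f a = 1"
  proof -
    have null: "(\<lambda>n. K * norm (x n - a)) \<longlonglongrightarrow> K * norm (a - a)" by (intro tendsto_intros a)
    have "(\<lambda>n. f (x n - a)) \<longlonglongrightarrow> 0"
      by (rule Lim_null_comparison[OF always_eventually[OF allI[OF bound]]]) (use null in simp)
    then have "(\<lambda>n. 1 - f a) \<longlonglongrightarrow> 0" using xS by (simp add: diff S_def)
    then show ?thesis by (simp add: LIMSEQ_const_iff)
  qed
  have orth: "cinner z a = 0" if "f z = 0" for z
  proof -
    have "cinner a z = 0"
    proof (rule orthogonal_if_norm_minimal)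
      fix c
      have "a + c *\<^sub>C z \<in> S" using \<open>f a = 1\<close> that by (simp add: S_def add scale)
      then show "norm a \<le> norm (a + c *\<^sub>C z)" using d_le na by simp
    qed
    then show ?thesis using cinner_commute[of z a] by simp
  qed
  have "a \<noteq> 0" using \<open>f a = 1\<close> scale[of 0 a] by auto
  show ?thesis
  proof (intro exI allI)
    fix x
    \<comment> \<open>Since \<open>f a = 1\<close>, subtracting \<open>f x\<close> times
      \<open>a\<close> moves \<open>x\<close> into the kernel of \<open>f\<close>.\<close>
    have "cinner (x - f x *\<^sub>C a) a = 0"
      by (rule orth) (simp add: diff scale \<open>f a = 1\<close>)
    then have "cinner x a = f x * of_real ((norm a)\<^sup>2)" by (simp only: cinner_simps cinner_self) simp
    then show "f x = cinner x (complex_of_real (inverse ((norm a)\<^sup>2)) *\<^sub>C a)"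
      using \<open>a \<noteq> 0\<close> by (simp add: cinner_scaleC_right)
  qed
qed

section \<open>Existence and calculus of adjoints\<close>

lemma bounded_opsD: "A \<in> bounded_ops \<Longrightarrow> blinfun_apply A (c *\<^sub>C x) = c *\<^sub>C blinfun_apply A x"
  by (simp add: bounded_ops_def)

text \<open>Test the identity with \<open>x = z\<close>. Only single vectors \<open>y\<close> and
  \<open>z\<close> occur, so the bound is available before the adjoint is known to be an
  operator.\<close>

lemma norm_le_if_adjoint:
  assumes "\<And>x. cinner (blinfun_apply A x) y = cinner x z"
  shows "norm z \<le> norm A * norm y"
proof (cases "z = 0")
  case False
  have "(norm z)\<^sup>2 = cmod (cinner (blinfun_apply A z) y)"
    by (simp add: assms cinner_self norm_power)
  also have "\<dots> \<le> norm (blinfun_apply A z) * norm y" by (rule cmod_cinner_le)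
  also have "\<dots> \<le> (norm A * norm z) * norm y"
    by (intro mult_right_mono norm_blinfun) simp
  finally show ?thesis using False by (simp add: power2_eq_square mult_ac)
qed simp

text \<open>Riesz gives the value of the adjoint at each \<open>y\<close> separately; uniqueness of
  representing vectors then makes these values depend linearly on \<open>y\<close>.\<close>

lemma adj_exists:
  fixes A :: "'a::complex_hilbert \<Rightarrow>\<^sub>L 'a"
  assumes A: "A \<in> bounded_ops"
  shows "\<exists>A'\<in>bounded_ops. \<forall>x y. cinner (blinfun_apply A x) y = cinner x (blinfun_apply A' y)"
proof -
  have "\<exists>z. \<forall>x. cinner (blinfun_apply A x) y = cinner x z" for y
  proof (rule riesz_representation)
    fix x
    have "cmod (cinner (blinfun_apply A x) y) \<le> norm (blinfun_apply A x) * norm y"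
      by (rule cmod_cinner_le)
    also have "\<dots> \<le> (norm A * norm x) * norm y"
      by (intro mult_right_mono norm_blinfun) simp
    finally show "cmod (cinner (blinfun_apply A x) y) \<le> (norm A * norm y) * norm x"
      by (simp add: mult_ac)
  qed (simp_all add: blinfun.add_right cinner_simps bounded_opsD[OF A])
  then obtain g where g: "\<And>x y. cinner (blinfun_apply A x) y = cinner x (g y)" by metis
  have add: "g (x + y) = g x + g y" for x y
    by (rule cinner_ext) (simp add: cinner_simps flip: g)
  have scale: "g (c *\<^sub>C x) = c *\<^sub>C g x" for c x
    by (rule cinner_ext) (simp add: cinner_simps flip: g)
  have bound: "norm (g y) \<le> norm y * norm A" for y
    using norm_le_if_adjoint[of A y "g y"] g by (simp add: mult.commute)
  have "bounded_linear g"
    by (rule bounded_linear_intro[OF add _ bound]) (simp add: scaleR_scaleC scale)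
  then show ?thesis
    using g scale by (intro bexI[of _ "Blinfun g"]) (auto simp: bounded_linear_Blinfun_apply bounded_ops_def)
qed

text \<open>Resolves the definite description in \<open>adj\<close>; every algebraic law for
  adjoints below is obtained by exhibiting the adjoint and applying this rule.\<close>

lemma adj_eqI:
  assumes "\<And>x y. cinner (blinfun_apply A x) y = cinner x (blinfun_apply A' y)"
  shows "adj A = A'"
  unfolding adj_def
proof (rule the_equality)
  fix C assume C: "\<forall>x y. cinner (blinfun_apply A x) y = cinner x (blinfun_apply C y)"
  show "C = A'" by (rule blinfun_eqI, rule cinner_ext) (simp add: C flip: assms)
qed (simp add: assms)

lemma
  assumes "A \<in> bounded_ops"
  shows cinner_adj: "cinner (blinfun_apply A x) y = cinner x (blinfun_apply (adj A) y)"
    and adj_in_bounded_ops: "adj A \<in> bounded_ops"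
  using adj_exists[OF assms] adj_eqI by metis+

lemma cinner_adj':
  assumes "A \<in> bounded_ops"
  shows "cinner (blinfun_apply (adj A) x) y = cinner x (blinfun_apply A y)"
  using cinner_adj[OF assms, of y x] by (metis cinner_commute)

lemma adj_adj: "A \<in> bounded_ops \<Longrightarrow> adj (adj A) = A"
  by (rule adj_eqI) (rule cinner_adj')

lemma bounded_ops_add: "A \<in> bounded_ops \<Longrightarrow> B \<in> bounded_ops \<Longrightarrow> A + B \<in> bounded_ops"
  and bounded_ops_diff: "A \<in> bounded_ops \<Longrightarrow> B \<in> bounded_ops \<Longrightarrow> A - B \<in> bounded_ops"
  and bounded_ops_scaleC: "A \<in> bounded_ops \<Longrightarrow> c *\<^sub>C A \<in> bounded_ops"
  and bounded_ops_compose: "A \<in> bounded_ops \<Longrightarrow> B \<in> bounded_ops \<Longrightarrow> A o\<^sub>L B \<in> bounded_ops"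
  and bounded_ops_zero: "0 \<in> bounded_ops"
  by (simp_all add: bounded_ops_def blinfun.add_left blinfun.diff_left scaleC_blinfun.rep_eq
      scaleC_add_right complex_vector.scale_right_diff_distrib scaleC_scaleC mult.commute)

lemma adj_add:
  "A \<in> bounded_ops \<Longrightarrow> B \<in> bounded_ops \<Longrightarrow> adj (A + B) = adj A + adj B"
  by (rule adj_eqI) (simp add: blinfun.add_left cinner_simps cinner_adj)

lemma adj_diff:
  "A \<in> bounded_ops \<Longrightarrow> B \<in> bounded_ops \<Longrightarrow> adj (A - B) = adj A - adj B"
  by (rule adj_eqI) (simp add: blinfun.diff_left cinner_simps cinner_adj)

lemma adj_scaleC: "A \<in> bounded_ops \<Longrightarrow> adj (c *\<^sub>C A) = cnj c *\<^sub>C adj A"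
  by (rule adj_eqI) (simp add: scaleC_blinfun.rep_eq cinner_simps cinner_adj)

lemma adj_compose:
  "A \<in> bounded_ops \<Longrightarrow> B \<in> bounded_ops \<Longrightarrow> adj (A o\<^sub>L B) = adj B o\<^sub>L adj A"
  by (rule adj_eqI) (simp add: cinner_adj)

lemma adj_zero: "adj 0 = 0"
  by (rule adj_eqI) simp

lemma norm_adj_le: "A \<in> bounded_ops \<Longrightarrow> norm (adj A) \<le> norm A"
  by (rule norm_blinfun_bound) (simp_all add: norm_le_if_adjoint cinner_adj)

lemma bounded_linear_scaleC: "bounded_linear (\<lambda>x::'a::complex_normed_vector. c *\<^sub>C x)"
  by (rule bounded_linear_intro[where K = "cmod c"])
     (simp_all add: scaleC_add_right scaleR_scaleC scaleC_scaleC norm_scaleC mult.commute)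

lemma closed_bounded_ops: "closed (bounded_ops :: ('a::complex_normed_vector \<Rightarrow>\<^sub>L 'a) set)"
proof -
  have eq: "bounded_ops = (\<Inter>c. \<Inter>x. {A. blinfun_apply A (c *\<^sub>C x) = c *\<^sub>C blinfun_apply (A :: 'a \<Rightarrow>\<^sub>L 'a) x})"
    by (auto simp: bounded_ops_def)
  have "closed {A. blinfun_apply A (c *\<^sub>C x) = c *\<^sub>C blinfun_apply (A :: 'a \<Rightarrow>\<^sub>L 'a) x}" for c x
    by (intro closed_Collect_eq continuous_intros bounded_linear.continuous_on[OF bounded_linear_scaleC])
  then show ?thesis unfolding eq by (intro closed_INT ballI)
qed

section \<open>Joint approximate eigenvectors of commuting symmetric operators\<close>

definition symmetric_op :: "('a::complex_inner \<Rightarrow>\<^sub>L 'a) \<Rightarrow> bool" where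
  "symmetric_op C \<longleftrightarrow> (\<forall>x y. cinner (blinfun_apply C x) y = cinner x (blinfun_apply C y))"

lemma symmetric_opD:
  "symmetric_op C \<Longrightarrow> cinner (blinfun_apply C x) y = cinner x (blinfun_apply C y)"
  by (simp add: symmetric_op_def)

lemma cinner_scaleR_left: "cinner (r *\<^sub>R x) y = of_real r * cinner x y"
  and cinner_scaleR_right: "cinner x (r *\<^sub>R y) = of_real r * cinner x y"
  by (simp_all add: scaleR_scaleC cinner_simps)

text \<open>Polarisation: the quadratic form is real, and its values at \<open>x + y\<close> and
  \<open>x + \<i> y\<close> fix the imaginary and real parts needed for conjugate symmetry.\<close>

lemma positive_op_symmetric:
  assumes B: "B \<in> bounded_ops" and pos: "positive_op B"
  shows "symmetric_op B"
  unfolding symmetric_op_def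
proof (intro allI)
  fix x y
  let ?s = "\<lambda>x y. cinner (blinfun_apply B x) y"
  have im: "Im (?s u u) = 0" for u
    using pos complex_nonneg_Reals_iff by (auto simp: positive_op_def)
  have "Im (?s x y) + Im (?s y x) = 0"
    using im[of "x + y"] im[of x] im[of y] by (simp add: blinfun.add_right cinner_simps)
  moreover have "Re (?s y x) = Re (?s x y)"
    using im[of "x + \<i> *\<^sub>C y"] im[of x] im[of y]
    by (simp add: blinfun.add_right bounded_opsD[OF B] cinner_simps)
  ultimately have "?s x y = cnj (?s y x)" by (simp add: complex_eq_iff)
  then show "?s x y = cinner x (blinfun_apply B y)" using cinner_commute by metis
qed

text \<open>An abstract seminorm lets the residuals of all eigenvalue equations imposed so far be
  handled as one quantity.\<close>

locale seminorm_fn =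
  fixes q :: "'a::real_normed_vector \<Rightarrow> real"
  assumes nonneg: "0 \<le> q x"
    and scale: "q (r *\<^sub>R x) = \<bar>r\<bar> * q x"
    and triangle: "q (x + y) \<le> q x + q y"

lemma seminorm_fn_norm_blinfun: "seminorm_fn (\<lambda>x. norm (blinfun_apply C x))"
  by standard (simp_all add: blinfun.scaleR_right blinfun.add_right norm_triangle_ineq)

lemma seminorm_fn_add:
  assumes "seminorm_fn p" "seminorm_fn q"
  shows "seminorm_fn (\<lambda>x. p x + q x)"
proof -
  interpret p: seminorm_fn p by fact
  interpret q: seminorm_fn q by fact
  show ?thesis
  proof
    show "p (x + y) + q (x + y) \<le> p x + q x + (p y + q y)" for x y
      using p.triangle[of x y] q.triangle[of x y] by simp
  qed (simp_all add: p.nonneg q.nonneg p.scale q.scale distrib_left)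
qed

lemma seminorm_fn_sum:
  "finite I \<Longrightarrow> (\<And>i. i \<in> I \<Longrightarrow> seminorm_fn (p i)) \<Longrightarrow> seminorm_fn (\<lambda>x. \<Sum>i\<in>I. p i x)"
  by (induction I rule: finite_induct) (auto intro: seminorm_fn_add simp: seminorm_fn.intro)

text \<open>In other words, \<open>q\<close> is not bounded below on the unit sphere. For
  \<open>q x = norm (C x - m x)\<close> this says that \<open>m\<close> is an approximate eigenvalue
  of \<open>C\<close>.\<close>

definition approx_null :: "('a::real_normed_vector \<Rightarrow> real) \<Rightarrow> bool" where
  "approx_null q \<longleftrightarrow> (\<forall>e>0. \<exists>x. norm x = 1 \<and> q x < e)"

text \<open>The eigenvalue is the largest \<open>m\<close> such that \<open>\<parallel>C x\<parallel>\<close> comes close to \<open>m\<close> on unit vectors where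
  \<open>q\<close> is small. For such \<open>x\<close> the vector \<open>C x\<close> is again almost null for \<open>q\<close>, so \<open>\<parallel>C (C x)\<parallel>\<close> is at
  most about \<open>m\<^sup>2\<close>, which forces \<open>C (C x) \<approx> m\<^sup>2 x\<close>; and \<open>C + m\<close> is bounded below because \<open>C \<ge> 0\<close>.\<close>

lemma approx_eigenvector_positive:
  fixes C :: "'a::complex_hilbert \<Rightarrow>\<^sub>L 'a"
  assumes q: "seminorm_fn q" and null: "approx_null q"
    and sym: "symmetric_op C" and pos: "\<And>x. 0 \<le> Re (cinner (blinfun_apply C x) x)"
    and inv: "\<And>x. q (blinfun_apply C x) \<le> K * q x"
  shows "\<exists>m::real. approx_null (\<lambda>x. q x + norm (blinfun_apply C x - m *\<^sub>R x))"
proof -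
  interpret seminorm_fn q by fact
  define G where "G = {m. 0 \<le> m \<and> (\<forall>e>0. \<exists>x. norm x = 1 \<and> q x < e \<and> m - e < norm (blinfun_apply C x))}"
  define m where "m = Sup G"
  have G0: "0 \<in> G"
    unfolding G_def
  proof (intro CollectI conjI allI impI)
    fix e :: real assume e: "e > 0"
    then obtain x where "norm x = 1" "q x < e" using null by (auto simp: approx_null_def)
    moreover have "0 - e < norm (blinfun_apply C x)"
      using e norm_ge_zero[of "blinfun_apply C x"] by linarith
    ultimately show "\<exists>x. norm x = 1 \<and> q x < e \<and> 0 - e < norm (blinfun_apply C x)" by blast
  qed simp
  have "g \<le> norm C" if g: "g \<in> G" for g
  proof (rule field_le_epsilon)
    fix e :: real assume "e > 0"
    then obtain x where x: "norm x = 1" "g - e < norm (blinfun_apply C x)"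
      using g unfolding G_def by blast
    then show "g \<le> norm C + e" using norm_blinfun[of C x] by simp
  qed
  then have bdd: "bdd_above G" by (rule bdd_aboveI)
  have m0: "0 \<le> m" unfolding m_def using G0 bdd by (rule cSup_upper)
  have low: "\<exists>x. norm x = 1 \<and> q x < e \<and> m - e < norm (blinfun_apply C x)" if "e > 0" for e
  proof -
    have "m - e/2 < Sup G" using that by (simp add: m_def)
    then obtain g where g: "g \<in> G" "m - e/2 < g" using less_cSupD[of G] G0 by blast
    have "e/2 > 0" using that by simp
    with g(1) obtain x where "norm x = 1" "q x < e/2" "g - e/2 < norm (blinfun_apply C x)"
      unfolding G_def by blast
    then show ?thesis using g(2) that by (intro exI[of _ x]) auto
  qed
  \<comment> \<open>Maximality of \<open>m\<close>, in homogeneous form because it will be applied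
    to \<open>C x\<close>, which is not a unit vector.\<close>
  have up: "\<exists>e>0. \<forall>y. y \<noteq> 0 \<longrightarrow> q y < e * norm y \<longrightarrow> norm (blinfun_apply C y) \<le> (m + \<eta>) * norm y"
    if \<eta>: "\<eta> > 0" for \<eta>
  proof -
    have "m + \<eta> \<notin> G" using cSup_upper[OF _ bdd, of "m + \<eta>"] \<eta> by (auto simp: m_def)
    moreover have "0 \<le> m + \<eta>" using m0 \<eta> by simp
    ultimately obtain e where e: "e > 0"
        and *: "\<And>x. norm x = 1 \<Longrightarrow> q x < e \<Longrightarrow> norm (blinfun_apply C x) \<le> m + \<eta> - e"
      unfolding G_def mem_Collect_eq by (meson not_less)
    have "norm (blinfun_apply C y) \<le> (m + \<eta>) * norm y" if y: "y \<noteq> 0" "q y < e * norm y" for y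
    proof -
      have "norm (blinfun_apply C (inverse (norm y) *\<^sub>R y)) \<le> m + \<eta> - e"
        using y by (intro *) (auto simp: scale field_simps)
      also have "\<dots> \<le> m + \<eta>" using e by simp
      finally show ?thesis using y by (simp add: blinfun.scaleR_right field_simps)
    qed
    then show ?thesis using e by blast
  qed
  have "approx_null (\<lambda>x. q x + norm (blinfun_apply C x - m *\<^sub>R x))"
  proof (cases "m = 0")
    \<comment> \<open>The operator \<open>C + m\<close> is bounded below only by \<open>m\<close>,
      so \<open>m = 0\<close> is treated apart: here \<open>up\<close> makes \<open>C x\<close>
      itself small.\<close>
    case True
    show ?thesis unfolding approx_null_def
    proof (intro allI impI)
      fix e :: real assume "e > 0"
      then obtain d where d: "d > 0"
        and *: "\<And>y. y \<noteq> 0 \<Longrightarrow> q y < d * norm y \<Longrightarrow> norm (blinfun_apply C y) \<le> e/2 * norm y"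
        using up[of "e/2"] True by auto
      obtain x where x: "norm x = 1" "q x < min d (e/2)"
        using null d \<open>e > 0\<close> unfolding approx_null_def by (metis half_gt_zero min_less_iff_conj)
      then have "norm (blinfun_apply C x) \<le> e/2" using *[of x] by fastforce
      then show "\<exists>x. norm x = 1 \<and> q x + norm (blinfun_apply C x - m *\<^sub>R x) < e"
        using x True by (intro exI[of _ x]) auto
    qed
  next
    case False
    then have m: "m > 0" using m0 by simp
    \<comment> \<open>The radicand bounds the square of \<open>norm (C (C x) - m\<^sup>2 x)\<close>,
      using the upper bound \<open>m + \<eta>\<close> and the lower bound \<open>m - \<eta>\<close>.
      Dividing by \<open>m\<close> undoes the factor \<open>C + m\<close>.\<close>
    define h where "h \<eta> = sqrt ((m + \<eta>)^4 - 2 * m\<^sup>2 * (m - \<eta>)\<^sup>2 + m^4) / m" for \<eta>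
    have key: "\<exists>x. norm x = 1 \<and> q x < \<eta> \<and> norm (blinfun_apply C x - m *\<^sub>R x) \<le> h \<eta>"
      if \<eta>: "0 < \<eta>" "\<eta> < m" for \<eta>
    proof -
      obtain e where e: "e > 0"
        and *: "\<And>y. y \<noteq> 0 \<Longrightarrow> q y < e * norm y \<Longrightarrow> norm (blinfun_apply C y) \<le> (m + \<eta>) * norm y"
        using up[OF \<eta>(1)] by blast
      \<comment> \<open>The third entry guarantees \<open>q (C x) < e * norm (C x)\<close>, so that
        \<open>*\<close> applies to \<open>C x\<close> as well; \<open>\<bar>K\<bar> + 1\<close>
        keeps the denominator positive.\<close>
      define d where "d = min \<eta> (min e (e * (m - \<eta>) / (\<bar>K\<bar> + 1)))"
      have "d > 0" using \<eta> e by (simp add: d_def)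
      from low[OF this] obtain x where x: "norm x = 1" "q x < d" "m - d < norm (blinfun_apply C x)"
        by blast
      let ?y = "blinfun_apply C x"
      have a: "m - \<eta> < norm ?y" using x(3) by (simp add: d_def)
      have y0: "?y \<noteq> 0" using a \<eta> by auto
      have "x \<noteq> 0" using x(1) by auto
      then have "norm ?y \<le> m + \<eta>" using *[of x] x by (simp add: d_def)
      have "q ?y \<le> K * q x" by (rule inv)
      also have "\<dots> \<le> (\<bar>K\<bar> + 1) * q x" by (intro mult_right_mono nonneg) simp
      also have "\<dots> < e * (m - \<eta>)" using x(2) by (simp add: d_def field_simps)
      also have "\<dots> \<le> e * norm ?y" using a e by simp
      finally have "norm (blinfun_apply C ?y) \<le> (m + \<eta>) * norm ?y" using * y0 by blast
      also have "\<dots> \<le> (m + \<eta>) * (m + \<eta>)"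
        using \<open>norm ?y \<le> m + \<eta>\<close> m \<eta> by (intro mult_left_mono) auto
      finally have CC: "(norm (blinfun_apply C ?y))\<^sup>2 \<le> (m + \<eta>)^4"
        using power_mono[of "norm (blinfun_apply C ?y)" "(m + \<eta>)\<^sup>2" 2]
        by (simp add: power2_eq_square power4_eq_xxxx mult_ac)
      have aa: "(m - \<eta>)\<^sup>2 \<le> (norm ?y)\<^sup>2" using a \<eta> by (intro power_mono) auto
      define z where "z = ?y - m *\<^sub>R x"
      \<comment> \<open>The factorisation \<open>C\<^sup>2 - m\<^sup>2 = (C + m) (C - m)\<close>,
        applied to \<open>x\<close>.\<close>
      have eq: "blinfun_apply C z + m *\<^sub>R z = blinfun_apply C ?y - m\<^sup>2 *\<^sub>R x"
        by (simp add: z_def blinfun.diff_right blinfun.scaleR_right scaleR_diff_right power2_eq_square)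
      have "Re (cinner (blinfun_apply C ?y) x) = (norm ?y)\<^sup>2"
        by (simp add: symmetric_opD[OF sym] norm_sq_cinner)
      then have "(norm (blinfun_apply C ?y - m\<^sup>2 *\<^sub>R x))\<^sup>2
          = (norm (blinfun_apply C ?y))\<^sup>2 - 2 * m\<^sup>2 * (norm ?y)\<^sup>2 + m^4"
        by (simp add: norm_diff_sq cinner_scaleR_right x(1) power_mult_distrib)
      also have "\<dots> \<le> (m + \<eta>)^4 - 2 * m\<^sup>2 * (m - \<eta>)\<^sup>2 + m^4"
        using CC mult_left_mono[OF aa, of "2 * m\<^sup>2"] by simp
      finally have 1: "norm (blinfun_apply C ?y - m\<^sup>2 *\<^sub>R x) \<le> m * h \<eta>"
        using m by (simp add: h_def real_le_rsqrt)
      \<comment> \<open>The cross term is nonnegative because \<open>C\<close> is positive, so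
        \<open>C + m\<close> is bounded below by \<open>m\<close>.\<close>
      have "(m * norm z)\<^sup>2 \<le> (norm (blinfun_apply C z + m *\<^sub>R z))\<^sup>2"
        using pos[of z] m by (simp add: norm_add_sq cinner_scaleR_right power_mult_distrib)
      then have "m * norm z \<le> norm (blinfun_apply C z + m *\<^sub>R z)" by (rule power2_le_imp_le) simp
      with 1 have "m * norm z \<le> m * h \<eta>" unfolding eq by linarith
      then have "norm z \<le> h \<eta>" using m by simp
      then show ?thesis using x by (auto simp: z_def d_def)
    qed
    show ?thesis unfolding approx_null_def
    proof (intro allI impI)
      fix e :: real assume e: "e > 0"
      \<comment> \<open>At \<eta> = 0 the radicand is \<open>m^4 - 2 m^4 + m^4 = 0\<close>.\<close>
      have "(h \<longlongrightarrow> sqrt ((m + 0)^4 - 2 * m\<^sup>2 * (m - 0)\<^sup>2 + m^4) / m) (at_right 0)"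
        unfolding h_def using m by (intro tendsto_intros) auto
      then have "(h \<longlongrightarrow> 0) (at_right 0)" by (simp add: power2_eq_square power4_eq_xxxx)
      then have "eventually (\<lambda>\<eta>. h \<eta> < e/2) (at_right 0)" using e by (intro order_tendstoD) auto
      moreover have "eventually (\<lambda>\<eta>. \<eta> \<in> {0<..<min m (e/2)}) (at_right 0)"
        using m e by (intro eventually_at_right_real) auto
      ultimately have "eventually (\<lambda>\<eta>. h \<eta> < e/2 \<and> \<eta> \<in> {0<..<min m (e/2)}) (at_right 0)"
        by (rule eventually_conj)
      then obtain \<eta> where "h \<eta> < e/2" "0 < \<eta>" "\<eta> < m" "\<eta> < e/2"
        using eventually_happens[of _ "at_right (0::real)"] by (auto simp: trivial_limit_at_right_real)
      then show "\<exists>x. norm x = 1 \<and> q x + norm (blinfun_apply C x - m *\<^sub>R x) < e"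
        using key[of \<eta>] by force
    qed
  qed
  then show ?thesis by blast
qed

text \<open>Adding \<open>norm C\<close> times the identity makes \<open>C\<close> positive and
  merely shifts the eigenvalue.\<close>

lemma approx_eigenvector_symmetric:
  fixes C :: "'a::complex_hilbert \<Rightarrow>\<^sub>L 'a"
  assumes q: "seminorm_fn q" and null: "approx_null q"
    and sym: "symmetric_op C"
    and inv: "\<And>x. q (blinfun_apply C x) \<le> K * q x"
  shows "\<exists>m::real. approx_null (\<lambda>x. q x + norm (blinfun_apply C x - m *\<^sub>R x))"
proof -
  interpret seminorm_fn q by fact
  let ?r = "norm C"
  let ?D = "C + ?r *\<^sub>R id_blinfun"
  have "\<exists>m::real. approx_null (\<lambda>x. q x + norm (blinfun_apply ?D x - m *\<^sub>R x))"
  proof (rule approx_eigenvector_positive[OF q null])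
    show "symmetric_op ?D"
      using sym by (simp add: symmetric_op_def blinfun.add_left blinfun.scaleR_left cinner_simps
          cinner_scaleR_left cinner_scaleR_right)
    show "0 \<le> Re (cinner (blinfun_apply ?D x) x)" for x
    proof -
      have "\<bar>Re (cinner (blinfun_apply C x) x)\<bar> \<le> norm (blinfun_apply C x) * norm x"
        using abs_Re_le_cmod cmod_cinner_le order_trans by blast
      also have "\<dots> \<le> ?r * norm x * norm x" by (intro mult_right_mono norm_blinfun) simp
      finally show ?thesis
        by (simp add: blinfun.add_left blinfun.scaleR_left cinner_add_left cinner_scaleR_left
            power2_eq_square mult.assoc flip: norm_sq_cinner)
    qed
    show "q (blinfun_apply ?D x) \<le> (K + ?r) * q x" for x
      using triangle[of "blinfun_apply C x" "?r *\<^sub>R x"] inv[of x]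
      by (simp add: blinfun.add_left blinfun.scaleR_left scale distrib_right)
  qed
  then obtain m where "approx_null (\<lambda>x. q x + norm (blinfun_apply ?D x - m *\<^sub>R x))" ..
  moreover have "blinfun_apply ?D x - m *\<^sub>R x = blinfun_apply C x - (m - ?r) *\<^sub>R x" for x
    by (simp add: blinfun.add_left blinfun.scaleR_left scaleR_diff_left)
  ultimately show ?thesis by (intro exI[of _ "m - ?r"]) simp
qed

text \<open>Induction on \<open>F\<close>: the residuals of the operators already treated are added
  to \<open>q\<close>. The next operator commutes with them, so it enlarges the new seminorm by at
  most a constant factor.\<close>

lemma joint_approx_eigenvector:
  fixes F :: "('a::complex_hilbert \<Rightarrow>\<^sub>L 'a) set"
  assumes "finite F" and q: "seminorm_fn q" "approx_null q"
    and "\<And>C. C \<in> F \<Longrightarrow> symmetric_op C"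
    and "\<And>C x. C \<in> F \<Longrightarrow> q (blinfun_apply C x) \<le> K C * q x"
    and "\<And>C D. C \<in> F \<Longrightarrow> D \<in> F \<Longrightarrow> C o\<^sub>L D = D o\<^sub>L C"
  shows "\<exists>m :: _ \<Rightarrow> real. approx_null (\<lambda>x. q x + (\<Sum>C\<in>F. norm (blinfun_apply C x - m C *\<^sub>R x)))"
  using assms(1,4-)
proof (induction F rule: finite_induct)
  case empty
  then show ?case using q by simp
next
  case (insert C F)
  obtain m where m: "approx_null (\<lambda>x. q x + (\<Sum>D\<in>F. norm (blinfun_apply D x - m D *\<^sub>R x)))"
    using insert.IH insert.prems by auto
  define p where "p x = q x + (\<Sum>D\<in>F. norm (blinfun_apply D x - m D *\<^sub>R x))" for x
  have "seminorm_fn (\<lambda>x. norm (blinfun_apply D x - m D *\<^sub>R x))" for D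
    using seminorm_fn_norm_blinfun[of "D - m D *\<^sub>R id_blinfun"]
    by (simp add: blinfun.diff_left blinfun.scaleR_left)
  then have p: "seminorm_fn p"
    unfolding p_def using q(1) insert.hyps by (intro seminorm_fn_add seminorm_fn_sum)
  have le: "norm (blinfun_apply D (blinfun_apply C x) - m D *\<^sub>R blinfun_apply C x)
      \<le> norm C * norm (blinfun_apply D x - m D *\<^sub>R x)" if "D \<in> F" for D x
  proof -
    have "C o\<^sub>L D = D o\<^sub>L C" using insert.prems(3) that by simp
    then have "blinfun_apply D (blinfun_apply C x) = blinfun_apply C (blinfun_apply D x)"
      by (metis blinfun_apply_blinfun_compose)
    then show ?thesis
      using norm_blinfun[of C "blinfun_apply D x - m D *\<^sub>R x"]
      by (simp add: blinfun.diff_right blinfun.scaleR_right)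
  qed
  \<comment> \<open>The constant dominates both the one for \<open>q\<close> and the one for the
    residuals.\<close>
  have "p (blinfun_apply C x) \<le> (\<bar>K C\<bar> + norm C) * p x" for x
  proof -
    let ?s = "\<Sum>D\<in>F. norm (blinfun_apply D x - m D *\<^sub>R x)"
    have "q (blinfun_apply C x) \<le> K C * q x" using insert.prems(2) by simp
    also have "\<dots> \<le> (\<bar>K C\<bar> + norm C) * q x"
      using seminorm_fn.nonneg[OF q(1), of x] norm_ge_zero[of C] by (intro mult_right_mono) linarith+
    finally have "q (blinfun_apply C x) \<le> (\<bar>K C\<bar> + norm C) * q x" .
    moreover have "(\<Sum>D\<in>F. norm (blinfun_apply D (blinfun_apply C x) - m D *\<^sub>R blinfun_apply C x))
        \<le> norm C * ?s"
      unfolding sum_distrib_left by (intro sum_mono le)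
    moreover have "norm C * ?s \<le> (\<bar>K C\<bar> + norm C) * ?s"
      by (intro mult_right_mono sum_nonneg) auto
    ultimately show ?thesis by (simp add: p_def distrib_left)
  qed
  then obtain k where k: "approx_null (\<lambda>x. p x + norm (blinfun_apply C x - k *\<^sub>R x))"
    using approx_eigenvector_symmetric[OF p] m insert.prems(1) unfolding p_def by blast
  have eq: "(\<Sum>D\<in>insert C F. norm (blinfun_apply D x - (m(C := k)) D *\<^sub>R x))
    = norm (blinfun_apply C x - k *\<^sub>R x) + (\<Sum>D\<in>F. norm (blinfun_apply D x - m D *\<^sub>R x))" for x
    using insert.hyps by (auto intro!: sum.cong)
  have "(\<lambda>x. q x + (\<Sum>D\<in>insert C F. norm (blinfun_apply D x - (m(C := k)) D *\<^sub>R x)))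
      = (\<lambda>x. p x + norm (blinfun_apply C x - k *\<^sub>R x))"
    unfolding eq p_def by (simp only: add_ac)
  with k show ?case by (intro exI[of _ "m(C := k)"]) (simp only:)
qed

section \<open>Characters\<close>

lemma cstar_subalgebra_bounded_ops: "cstar_subalgebra bounded_ops"
  by (simp add: cstar_subalgebra_def closed_bounded_ops bounded_ops_zero bounded_ops_add
      bounded_ops_compose bounded_ops_scaleC adj_in_bounded_ops)

lemma cstar_subalgebra_Inter:
  assumes "Q \<noteq> {}" and "\<And>S. S \<in> Q \<Longrightarrow> cstar_subalgebra S"
  shows "cstar_subalgebra (\<Inter>Q)"
proof -
  have "closed (\<Inter>Q)" using assms(2) by (intro closed_Inter) (auto simp: cstar_subalgebra_def)
  then show ?thesis using assms unfolding cstar_subalgebra_def by blast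
qed

text \<open>\<open>bounded_ops\<close> belongs to the family being intersected, so the hull is an
  intersection of a nonempty family.\<close>

lemma cstar_subalgebra_generated:
  "G \<subseteq> bounded_ops \<Longrightarrow> cstar_subalgebra (generated_cstar_algebra G)"
  unfolding generated_cstar_algebra_def hull_def
  by (rule cstar_subalgebra_Inter) (use cstar_subalgebra_bounded_ops in auto)

lemma generated_cstar_algebra_superset: "G \<subseteq> generated_cstar_algebra G"
  unfolding generated_cstar_algebra_def by (rule hull_subset)

text \<open>Otherwise \<open>W = (X + w) / (\<omega> X + w)\<close> would have norm less than one. If \<open>\<omega> Y = 1\<close>, then the
  Neumann series gives \<open>V\<close> in \<open>S\<close> with \<open>V = Y + W V\<close>, and applying \<open>\<omega>\<close> yields
  \<open>\<omega> V = 1 + \<omega> V\<close>.\<close>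

lemma character_shifted_bound:
  assumes S: "cstar_subalgebra S" and \<omega>: "\<omega> \<in> characters_on S" and X: "X \<in> S"
  shows "cmod (\<omega> X + w) \<le> norm (X + w *\<^sub>C id_blinfun)"
proof (rule ccontr)
  assume neg: "\<not> ?thesis"
  define s where "s = \<omega> X + w"
  define W where "W = inverse s *\<^sub>C (X + w *\<^sub>C id_blinfun)"
  have lt: "norm (X + w *\<^sub>C id_blinfun) < cmod s" using neg by (simp add: s_def)
  then have s0: "s \<noteq> 0" using norm_ge_zero[of "X + w *\<^sub>C id_blinfun"] by force
  have "norm W = norm (X + w *\<^sub>C id_blinfun) / cmod s"
    unfolding W_def norm_scaleC norm_inverse by (simp add: divide_inverse mult.commute)
  then have W1: "norm W < 1" using lt s0 by simp
  have \<omega>_add: "\<omega> (P + Q) = \<omega> P + \<omega> Q" and \<omega>_comp: "\<omega> (P o\<^sub>L Q) = \<omega> P * \<omega> Q"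
    if "P \<in> S" "Q \<in> S" for P Q using \<omega> that by (auto simp: characters_on_def)
  have \<omega>_scale: "\<omega> (c *\<^sub>C P) = c * \<omega> P" if "P \<in> S" for P c
    using \<omega> that by (auto simp: characters_on_def)
  have S_add: "P + Q \<in> S" and S_comp: "P o\<^sub>L Q \<in> S" if "P \<in> S" "Q \<in> S" for P Q
    using S that by (auto simp: cstar_subalgebra_def)
  have S_scale: "c *\<^sub>C P \<in> S" if "P \<in> S" for P c
    using S that by (auto simp: cstar_subalgebra_def)
  obtain Y\<^sub>0 where Y0: "Y\<^sub>0 \<in> S" "\<omega> Y\<^sub>0 \<noteq> 0" using \<omega> by (auto simp: characters_on_def)
  define Y where "Y = inverse (\<omega> Y\<^sub>0) *\<^sub>C Y\<^sub>0"
  have Y: "Y \<in> S" "\<omega> Y = 1" using Y0 by (auto simp: Y_def S_scale \<omega>_scale)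
  \<comment> \<open>The identity, and with it \<open>W\<close>, need not lie in \<open>S\<close>.
    Only products of \<open>W\<close> with elements of \<open>S\<close> are used; on these \<omega>
    acts as if \<open>W\<close> had the value 1.\<close>
  have WZ: "W o\<^sub>L Z = inverse s *\<^sub>C ((X o\<^sub>L Z) + w *\<^sub>C Z)" for Z
    by (rule blinfun_eqI) (simp add: W_def scaleC_blinfun.rep_eq blinfun.add_left)
  have W_in: "W o\<^sub>L Z \<in> S" if "Z \<in> S" for Z
    unfolding WZ using X that by (intro S_scale S_add S_comp)
  have \<omega>W: "\<omega> (W o\<^sub>L Z) = \<omega> Z" if "Z \<in> S" for Z
  proof -
    have "\<omega> (W o\<^sub>L Z) = inverse s * (\<omega> X * \<omega> Z + w * \<omega> Z)"
      unfolding WZ using X that by (simp add: \<omega>_add \<omega>_scale \<omega>_comp S_scale S_add S_comp)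
    also have "\<dots> = inverse s * s * \<omega> Z" by (simp add: s_def algebra_simps)
    finally show ?thesis using s0 by simp
  qed
  define T where "T k = ((\<lambda>Z. W o\<^sub>L Z) ^^ k) Y" for k
  have T_Suc: "T (Suc k) = W o\<^sub>L T k" for k by (simp add: T_def)
  have T_in: "T k \<in> S" for k
    by (induction k) (simp_all add: T_Suc W_in, simp add: T_def Y)
  have T_le: "norm (T k) \<le> norm Y * norm W ^ k" for k
  proof (induction k)
    case (Suc k)
    have "norm (T (Suc k)) \<le> norm W * norm (T k)" unfolding T_Suc by (rule norm_blinfun_compose)
    also have "\<dots> \<le> norm W * (norm Y * norm W ^ k)" by (intro mult_left_mono Suc) simp
    finally show ?case by (simp add: mult_ac)
  qed (simp add: T_def)
  have summable: "summable T"
    by (rule summable_comparison_test'[where g = "\<lambda>k. norm Y * norm W ^ k" and N = 0])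
       (use W1 T_le in \<open>auto intro!: summable_mult summable_geometric\<close>)
  define V where "V = suminf T"
  have partial: "(\<Sum>k<n. T k) \<in> S" for n
    by (induction n) (use S T_in S_add in \<open>auto simp: cstar_subalgebra_def\<close>)
  have "closed S" using S by (simp add: cstar_subalgebra_def)
  then have V_in: "V \<in> S"
    by (rule closed_sequentially) (use partial summable_LIMSEQ[OF summable] in \<open>auto simp: V_def\<close>)
  have "bounded_linear (\<lambda>Z. W o\<^sub>L Z)"
    by (rule bounded_bilinear.bounded_linear_right[OF bounded_bilinear_blinfun_compose])
  from bounded_linear.suminf[OF this summable] have "W o\<^sub>L V = (\<Sum>k. T (Suc k))"
    by (simp add: V_def T_Suc)
  also have "\<dots> = V - Y" using suminf_split_head[OF summable] by (simp add: V_def T_def)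
  \<comment> \<open>The infinite sum is removed before \<omega> is applied, so continuity of
    \<omega> is not presupposed.\<close>
  finally have "V = Y + (W o\<^sub>L V)" by simp
  then have "\<omega> V = \<omega> Y + \<omega> (W o\<^sub>L V)" using \<omega>_add[OF Y(1) W_in[OF V_in]] by simp
  then show False using \<omega>W[OF V_in] Y(2) by simp
qed

lemma character_bound:
  assumes "cstar_subalgebra S" and "\<omega> \<in> characters_on S" and "X \<in> S"
  shows "cmod (\<omega> X) \<le> norm X"
  using character_shifted_bound[OF assms, of 0] by simp

text \<open>The terms \<open>(cmod w)\<^sup>2\<close> cancel and leave an inequality affine in
  \<open>w\<close>. Letting \<open>w\<close> run along the negative real axis excludes a negative
  real part, and along the imaginary axis a nonzero imaginary part.\<close>

lemma nonneg_if_shift_bound: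
  assumes "\<And>w. Re w \<le> 0 \<Longrightarrow> (cmod (\<mu> + w))\<^sup>2 \<le> K + (cmod w)\<^sup>2"
  shows "\<mu> \<in> \<real>\<^sub>\<ge>\<^sub>0"
proof -
  have re: "(cmod \<mu>)\<^sup>2 - 2 * Re \<mu> * s \<le> K" if "s \<ge> 0" for s
    using assms[of "- of_real s"] that unfolding cmod_power2 by (simp add: power2_eq_square algebra_simps)
  have im: "(cmod \<mu>)\<^sup>2 + 2 * Im \<mu> * s \<le> K" for s
    using assms[of "\<i> * of_real s"] unfolding cmod_power2 by (simp add: power2_eq_square algebra_simps)
  have "0 \<le> Re \<mu>"
  proof (rule ccontr)
    assume neg: "\<not> ?thesis"
    \<comment> \<open>This parameter makes the affine term contribute
      \<open>\<bar>K\<bar> + 1\<close>, more than \<open>K\<close> allows.\<close>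
    then have "2 * Re \<mu> * ((\<bar>K\<bar> + 1) / (- 2 * Re \<mu>)) = - (\<bar>K\<bar> + 1)" by (simp add: field_simps)
    moreover have "0 \<le> (\<bar>K\<bar> + 1) / (- 2 * Re \<mu>)" using neg by (intro divide_nonneg_pos) auto
    ultimately show False using re[of "(\<bar>K\<bar> + 1) / (- 2 * Re \<mu>)"] zero_le_power2[of "cmod \<mu>"] by linarith
  qed
  moreover have "Im \<mu> = 0"
  proof (rule ccontr)
    assume "\<not> ?thesis"
    then have "2 * Im \<mu> * ((\<bar>K\<bar> + 1) / (2 * Im \<mu>)) = \<bar>K\<bar> + 1" by simp
    then show False using im[of "(\<bar>K\<bar> + 1) / (2 * Im \<mu>)"] zero_le_power2[of "cmod \<mu>"] by linarith
  qed
  ultimately show ?thesis by (simp add: complex_nonneg_Reals_iff)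
qed

text \<open>For positive \<open>B\<close> and \<open>Re w \<le> 0\<close> the cross term in the
  square of \<open>norm (B x + w x)\<close> is at most zero. Combined with
  \<open>character_shifted_bound\<close> this is the hypothesis of
  \<open>nonneg_if_shift_bound\<close>.\<close>

lemma character_positive_op:
  assumes S: "cstar_subalgebra S" and \<omega>: "\<omega> \<in> characters_on S" and B: "B \<in> S"
    and pos: "positive_op B"
  shows "\<omega> B \<in> \<real>\<^sub>\<ge>\<^sub>0"
proof (rule nonneg_if_shift_bound)
  fix w :: complex assume w: "Re w \<le> 0"
  have "norm (blinfun_apply (B + w *\<^sub>C id_blinfun) x) \<le> sqrt ((norm B)\<^sup>2 + (cmod w)\<^sup>2) * norm x" for x
  proof (rule power2_le_imp_le)
    let ?r = "Re (cinner (blinfun_apply B x) x)"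
    have "cinner (blinfun_apply B x) x \<in> \<real>\<^sub>\<ge>\<^sub>0" using pos by (simp add: positive_op_def)
    then have r: "0 \<le> ?r" "Im (cinner (blinfun_apply B x) x) = 0"
      by (simp_all add: complex_nonneg_Reals_iff)
    have "(norm (blinfun_apply (B + w *\<^sub>C id_blinfun) x))\<^sup>2
        = (norm (blinfun_apply B x))\<^sup>2 + 2 * (Re w * ?r) + (cmod w)\<^sup>2 * (norm x)\<^sup>2"
      by (simp add: blinfun.add_left scaleC_blinfun.rep_eq norm_add_sq cinner_scaleC_right
          norm_scaleC power_mult_distrib r)
    also have "\<dots> \<le> (norm B * norm x)\<^sup>2 + (cmod w)\<^sup>2 * (norm x)\<^sup>2"
      using mult_nonpos_nonneg[OF w r(1)] power_mono[OF norm_blinfun[of B x] norm_ge_zero, of 2]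
      by linarith
    finally show "(norm (blinfun_apply (B + w *\<^sub>C id_blinfun) x))\<^sup>2
        \<le> (sqrt ((norm B)\<^sup>2 + (cmod w)\<^sup>2) * norm x)\<^sup>2"
      by (simp add: power_mult_distrib distrib_right)
  qed simp
  then have "norm (B + w *\<^sub>C id_blinfun) \<le> sqrt ((norm B)\<^sup>2 + (cmod w)\<^sup>2)"
    by (intro norm_blinfun_bound) simp_all
  with character_shifted_bound[OF S \<omega> B, of w]
  have "cmod (\<omega> B + w) \<le> sqrt ((norm B)\<^sup>2 + (cmod w)\<^sup>2)" by linarith
  then have "(cmod (\<omega> B + w))\<^sup>2 \<le> (sqrt ((norm B)\<^sup>2 + (cmod w)\<^sup>2))\<^sup>2" by (intro power_mono) simp_all
  then show "(cmod (\<omega> B + w))\<^sup>2 \<le> (norm B)\<^sup>2 + (cmod w)\<^sup>2" by simp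
qed

section \<open>Limit eigenvalues\<close>

text \<open>The sequence is a parameter shared by all operators; this is what makes limit
  eigenvalues add and multiply. That its members are unit vectors is assumed separately, where
  uniqueness is at stake.\<close>

definition limit_eigenvalue ::
    "(nat \<Rightarrow> 'a::complex_normed_vector) \<Rightarrow> ('a \<Rightarrow>\<^sub>L 'a) \<Rightarrow> complex \<Rightarrow> bool" where
  "limit_eigenvalue x X c \<longleftrightarrow> (\<lambda>n. blinfun_apply X (x n) - c *\<^sub>C x n) \<longlonglongrightarrow> 0"

lemma limit_eigenvalue_add:
  assumes "limit_eigenvalue x X c" "limit_eigenvalue x Y d"
  shows "limit_eigenvalue x (X + Y) (c + d)"
proof -
  have "blinfun_apply (X + Y) (x n) - (c + d) *\<^sub>C x n
      = (blinfun_apply X (x n) - c *\<^sub>C x n) + (blinfun_apply Y (x n) - d *\<^sub>C x n)" for n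
    by (simp add: blinfun.add_left scaleC_add_left)
  then show ?thesis
    using tendsto_add_zero[OF assms[unfolded limit_eigenvalue_def]]
    by (simp add: limit_eigenvalue_def)
qed

lemma limit_eigenvalue_scaleC:
  assumes "limit_eigenvalue x X c"
  shows "limit_eigenvalue x (a *\<^sub>C X) (a * c)"
proof -
  have "blinfun_apply (a *\<^sub>C X) (x n) - (a * c) *\<^sub>C x n = a *\<^sub>C (blinfun_apply X (x n) - c *\<^sub>C x n)" for n
    by (simp add: scaleC_blinfun.rep_eq complex_vector.scale_right_diff_distrib scaleC_scaleC)
  then show ?thesis
    using bounded_linear.tendsto_zero[OF bounded_linear_scaleC assms[unfolded limit_eigenvalue_def]]
    by (simp add: limit_eigenvalue_def)
qed

lemma limit_eigenvalue_diff:
  assumes "limit_eigenvalue x X c" "limit_eigenvalue x Y d"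
  shows "limit_eigenvalue x (X - Y) (c - d)"
  using limit_eigenvalue_add[OF assms(1) limit_eigenvalue_scaleC[OF assms(2), of "-1"]] by simp

lemma limit_eigenvalue_compose:
  assumes X: "X \<in> bounded_ops" "limit_eigenvalue x X c" and Y: "limit_eigenvalue x Y d"
  shows "limit_eigenvalue x (X o\<^sub>L Y) (c * d)"
proof -
  have "(\<lambda>n. blinfun_apply X (blinfun_apply Y (x n) - d *\<^sub>C x n)) \<longlonglongrightarrow> 0"
    by (rule bounded_linear.tendsto_zero[OF blinfun.bounded_linear_right Y[unfolded limit_eigenvalue_def]])
  moreover have "(\<lambda>n. d *\<^sub>C (blinfun_apply X (x n) - c *\<^sub>C x n)) \<longlonglongrightarrow> 0"
    by (rule bounded_linear.tendsto_zero[OF bounded_linear_scaleC X(2)[unfolded limit_eigenvalue_def]])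
  ultimately have "(\<lambda>n. blinfun_apply X (blinfun_apply Y (x n) - d *\<^sub>C x n)
      + d *\<^sub>C (blinfun_apply X (x n) - c *\<^sub>C x n)) \<longlonglongrightarrow> 0"
    by (rule tendsto_add_zero)
  \<comment> \<open>Complex linearity of \<open>X\<close> moves \<open>d\<close> past
    \<open>X\<close>, and the two mixed terms cancel.\<close>
  moreover have "blinfun_apply X (blinfun_apply Y (x n) - d *\<^sub>C x n)
      + d *\<^sub>C (blinfun_apply X (x n) - c *\<^sub>C x n) = blinfun_apply (X o\<^sub>L Y) (x n) - (c * d) *\<^sub>C x n" for n
    by (simp add: blinfun.diff_right bounded_opsD[OF X(1)] complex_vector.scale_right_diff_distrib
        scaleC_scaleC mult.commute)
  ultimately show ?thesis by (simp add: limit_eigenvalue_def)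
qed

lemma limit_eigenvalue_zero: "limit_eigenvalue x 0 0"
  by (simp add: limit_eigenvalue_def)

lemma limit_eigenvalue_le:
  assumes x: "\<And>n. norm (x n) = 1" and ev: "limit_eigenvalue x X c"
  shows "cmod c \<le> norm X"
proof (rule LIMSEQ_le_const)
  show "(\<lambda>n. norm (blinfun_apply X (x n) - c *\<^sub>C x n) + norm X) \<longlonglongrightarrow> norm X"
    using tendsto_add[OF tendsto_norm[OF ev[unfolded limit_eigenvalue_def]] tendsto_const] by simp
  have "cmod c \<le> norm (blinfun_apply X (x n) - c *\<^sub>C x n) + norm X" for n
    using norm_triangle_sub[of "c *\<^sub>C x n" "blinfun_apply X (x n)"] norm_blinfun[of X "x n"]
    by (simp add: norm_scaleC x norm_minus_commute)
  then show "\<exists>N. \<forall>n\<ge>N. cmod c \<le> norm (blinfun_apply X (x n) - c *\<^sub>C x n) + norm X" by blast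
qed

text \<open>The difference \<open>c - d\<close> is a limit eigenvalue of \<open>X - X = 0\<close>,
  hence bounded by 0.\<close>

lemma limit_eigenvalue_unique:
  assumes "\<And>n. norm (x n) = 1" "limit_eigenvalue x X c" "limit_eigenvalue x X d"
  shows "c = d"
  using limit_eigenvalue_le[OF assms(1) limit_eigenvalue_diff[OF assms(2,3)]] by simp

lemma limit_eigenvalue_limit:
  assumes x: "\<And>n. norm (x n) = 1" and ev: "\<And>k. limit_eigenvalue x (X k) (c k)"
    and X: "X \<longlonglongrightarrow> Y" and c: "c \<longlonglongrightarrow> d"
  shows "limit_eigenvalue x Y d"
  unfolding limit_eigenvalue_def
proof (rule LIMSEQ_I)
  fix e :: real assume "e > 0"
  have "eventually (\<lambda>k. dist (X k) Y < e/3) sequentially" "eventually (\<lambda>k. dist (c k) d < e/3) sequentially"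
    using tendstoD[OF X, of "e/3"] tendstoD[OF c, of "e/3"] \<open>e > 0\<close> by simp_all
  then have "eventually (\<lambda>k. dist (X k) Y < e/3 \<and> dist (c k) d < e/3) sequentially"
    by (rule eventually_conj)
  then obtain k where k: "norm (Y - X k) < e/3" "cmod (c k - d) < e/3"
    using eventually_happens'[OF sequentially_bot] by (auto simp: dist_norm norm_minus_commute)
  obtain N where N: "\<And>n. n \<ge> N \<Longrightarrow> norm (blinfun_apply (X k) (x n) - c k *\<^sub>C x n) < e/3"
    using LIMSEQ_D[OF ev[of k, unfolded limit_eigenvalue_def], of "e/3"] \<open>e > 0\<close> by auto
  show "\<exists>N. \<forall>n\<ge>N. norm (blinfun_apply Y (x n) - d *\<^sub>C x n - 0) < e"
  proof (intro exI allI impI)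
    fix n assume "N \<le> n"
    let ?u = "blinfun_apply (X k) (x n) - c k *\<^sub>C x n"
    have eq: "blinfun_apply Y (x n) - d *\<^sub>C x n
        = (blinfun_apply (Y - X k) (x n) + (c k - d) *\<^sub>C x n) + ?u"
      by (simp add: blinfun.diff_left complex_vector.scale_left_diff_distrib)
    have "norm (blinfun_apply Y (x n) - d *\<^sub>C x n)
        \<le> norm (blinfun_apply (Y - X k) (x n)) + norm ((c k - d) *\<^sub>C x n) + norm ?u"
      unfolding eq by (intro order_trans[OF norm_triangle_ineq] add_right_mono norm_triangle_ineq)
    also have "\<dots> < e"
      using norm_blinfun[of "Y - X k" "x n"] k N[OF \<open>N \<le> n\<close>] by (simp add: x norm_scaleC)
    finally show "norm (blinfun_apply Y (x n) - d *\<^sub>C x n - 0) < e" by simp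
  qed
qed

text \<open>The condition on the adjoint makes the set of operators with such a value closed under
  \<open>adj\<close>, as a C*-algebra must be.\<close>

definition star_limit_eigenvalue ::
    "(nat \<Rightarrow> 'a::complex_hilbert) \<Rightarrow> ('a \<Rightarrow>\<^sub>L 'a) \<Rightarrow> complex \<Rightarrow> bool" where
  "star_limit_eigenvalue x X c \<longleftrightarrow> limit_eigenvalue x X c \<and> limit_eigenvalue x (adj X) (cnj c)"

lemma star_limit_eigenvalue_add:
  assumes "X \<in> bounded_ops" "Y \<in> bounded_ops"
    and "star_limit_eigenvalue x X c" "star_limit_eigenvalue x Y d"
  shows "star_limit_eigenvalue x (X + Y) (c + d)"
  using assms by (simp add: star_limit_eigenvalue_def limit_eigenvalue_add adj_add)

lemma star_limit_eigenvalue_scaleC: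
  assumes "X \<in> bounded_ops" "star_limit_eigenvalue x X c"
  shows "star_limit_eigenvalue x (a *\<^sub>C X) (a * c)"
  using assms by (simp add: star_limit_eigenvalue_def limit_eigenvalue_scaleC adj_scaleC)

lemma star_limit_eigenvalue_compose:
  assumes "X \<in> bounded_ops" "Y \<in> bounded_ops"
    and "star_limit_eigenvalue x X c" "star_limit_eigenvalue x Y d"
  shows "star_limit_eigenvalue x (X o\<^sub>L Y) (c * d)"
  using assms limit_eigenvalue_compose[of "adj Y" x "cnj d" "adj X" "cnj c"]
  by (simp add: star_limit_eigenvalue_def limit_eigenvalue_compose adj_compose adj_in_bounded_ops
      mult.commute)

lemma star_limit_eigenvalue_adj:
  "X \<in> bounded_ops \<Longrightarrow> star_limit_eigenvalue x X c \<Longrightarrow> star_limit_eigenvalue x (adj X) (cnj c)"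
  by (simp add: star_limit_eigenvalue_def adj_adj)

text \<open>Limit eigenvalues of differences are bounded by operator norms, so the eigenvalues along
  a convergent sequence of operators are Cauchy. The adjoints converge too, because
  \<open>adj\<close> does not increase norms.\<close>

lemma closed_star_limit_eigenvalue:
  assumes x: "\<And>n. norm (x n) = 1"
  shows "closed {X \<in> bounded_ops. \<exists>c. star_limit_eigenvalue x X c}"
  unfolding closed_sequential_limits
proof (intro allI impI, elim conjE)
  fix X Y assume "\<forall>k. X k \<in> {X \<in> bounded_ops. \<exists>c. star_limit_eigenvalue x X c}" and lim: "X \<longlonglongrightarrow> Y"
  then have X: "\<And>k. X k \<in> bounded_ops" and "\<forall>k. \<exists>c. star_limit_eigenvalue x (X k) c" by auto
  then obtain c where c: "\<And>k. star_limit_eigenvalue x (X k) (c k)" by metis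
  have Y: "Y \<in> bounded_ops" using closed_sequentially[OF closed_bounded_ops] X lim by blast
  have "Cauchy c"
  proof (rule CauchyI)
    fix e :: real assume "e > 0"
    with LIMSEQ_imp_Cauchy[OF lim] obtain M
      where M: "\<And>m n. m \<ge> M \<Longrightarrow> n \<ge> M \<Longrightarrow> norm (X m - X n) < e" using CauchyD by blast
    have "cmod (c m - c n) \<le> norm (X m - X n)" for m n
      using limit_eigenvalue_le[of x, OF x limit_eigenvalue_diff] c by (simp add: star_limit_eigenvalue_def)
    with M show "\<exists>M. \<forall>m\<ge>M. \<forall>n\<ge>M. cmod (c m - c n) < e" by (meson le_less_trans)
  qed
  then obtain d where d: "c \<longlonglongrightarrow> d" using Cauchy_convergent convergent_def by blast
  have "(\<lambda>k. adj (X k)) \<longlonglongrightarrow> adj Y"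
  proof (rule metric_tendsto_imp_tendsto[OF lim])
    have "norm (adj (X k) - adj Y) \<le> norm (X k - Y)" for k
      using norm_adj_le[OF bounded_ops_diff[OF X Y]] by (simp add: adj_diff X Y)
    then show "\<forall>\<^sub>F k in sequentially. dist (adj (X k)) (adj Y) \<le> dist (X k) Y" by (simp add: dist_norm)
  qed
  moreover have "limit_eigenvalue x (X k) (c k)" "limit_eigenvalue x (adj (X k)) (cnj (c k))" for k
    using c[of k] by (simp_all add: star_limit_eigenvalue_def)
  ultimately have "star_limit_eigenvalue x Y d"
    unfolding star_limit_eigenvalue_def
    using limit_eigenvalue_limit[of x, OF x _ lim d]
      limit_eigenvalue_limit[of x "\<lambda>k. adj (X k)", OF x _ _ tendsto_cnj[OF d]] by blast
  then show "Y \<in> {X \<in> bounded_ops. \<exists>c. star_limit_eigenvalue x X c}" using Y by blast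
qed

lemma cstar_subalgebra_star_limit_eigenvalue:
  assumes "\<And>n. norm (x n) = 1"
  shows "cstar_subalgebra {X \<in> bounded_ops. \<exists>c. star_limit_eigenvalue x X c}"
proof -
  have "star_limit_eigenvalue x 0 0"
    by (simp add: star_limit_eigenvalue_def adj_zero limit_eigenvalue_zero)
  then show ?thesis
    unfolding cstar_subalgebra_def using closed_star_limit_eigenvalue[OF assms]
    by (auto simp: bounded_ops_zero bounded_ops_add bounded_ops_compose bounded_ops_scaleC
        adj_in_bounded_ops
        intro: star_limit_eigenvalue_add star_limit_eigenvalue_compose
          star_limit_eigenvalue_scaleC star_limit_eigenvalue_adj)
qed

text \<open>The character sends an operator to its limit eigenvalue along \<open>x\<close>.
  Minimality of the hull provides one for every member of the generated algebra, and excluding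
  \<open>(0, 0)\<close> makes the functional nonzero.\<close>

lemma star_limit_eigenvalues_in_joint_spectrum:
  assumes AB: "A \<in> bounded_ops" "B \<in> bounded_ops" and x: "\<And>n. norm (x n) = 1"
    and A: "star_limit_eigenvalue x A \<zeta>" and B: "star_limit_eigenvalue x B \<eta>"
    and nz: "(\<zeta>, \<eta>) \<noteq> (0, 0)"
  shows "(\<zeta>, \<eta>) \<in> joint_spectrum A B"
proof -
  let ?S = "generated_cstar_algebra {A, B}"
  define \<omega> where "\<omega> X = (THE c. limit_eigenvalue x X c)" for X
  have \<omega>_eq: "\<omega> X = c" if "limit_eigenvalue x X c" for X c
    unfolding \<omega>_def using that limit_eigenvalue_unique[of x, OF x] by blast
  have "?S \<subseteq> {X \<in> bounded_ops. \<exists>c. star_limit_eigenvalue x X c}"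
    unfolding generated_cstar_algebra_def
    by (rule hull_minimal, use AB A B in blast) (rule cstar_subalgebra_star_limit_eigenvalue[of x, OF x])
  then have S: "X \<in> bounded_ops" "limit_eigenvalue x X (\<omega> X)" if "X \<in> ?S" for X
    using that \<omega>_eq by (auto simp: star_limit_eigenvalue_def)
  have \<omega>AB: "\<omega> A = \<zeta>" "\<omega> B = \<eta>"
    using A B by (auto simp: star_limit_eigenvalue_def intro: \<omega>_eq)
  have "A \<in> ?S" "B \<in> ?S" using generated_cstar_algebra_superset[of "{A, B}"] by auto
  moreover from this have "\<exists>X\<in>?S. \<omega> X \<noteq> 0" using \<omega>AB nz by auto
  ultimately have "\<omega> \<in> characters_on ?S"
    using S unfolding characters_on_def
    by (auto intro!: \<omega>_eq limit_eigenvalue_add limit_eigenvalue_scaleC limit_eigenvalue_compose)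
  then show ?thesis unfolding joint_spectrum_def using \<omega>AB by blast
qed

section \<open>The norm as a maximum over the joint spectrum\<close>

lemma exists_unit_vector_near_norm:
  fixes N :: "'a::real_normed_vector \<Rightarrow>\<^sub>L 'b::real_normed_vector"
  assumes "0 \<le> r" "r < norm N"
  shows "\<exists>x. norm x = 1 \<and> r < norm (blinfun_apply N x)"
proof (rule ccontr)
  assume neg: "\<not> ?thesis"
  have "norm (blinfun_apply N x) \<le> r * norm x" for x
  proof (cases "x = 0")
    case False
    then have "norm (blinfun_apply N (inverse (norm x) *\<^sub>R x)) \<le> r" using neg by (simp add: not_less)
    then show ?thesis using False by (simp add: blinfun.scaleR_right field_simps)
  qed simp
  then have "norm N \<le> r" using assms(1) by (intro norm_blinfun_bound)
  then show False using assms(2) by simp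
qed

text \<open>Expanding the squared norm of \<open>N\<^sup>* N x - (norm N)\<^sup>2 x\<close> shows
  that it is small as soon as \<open>norm (N x)\<close> is close to \<open>norm N\<close>.\<close>

lemma approx_null_norm_attained:
  fixes N :: "'a::complex_hilbert \<Rightarrow>\<^sub>L 'a"
  assumes N: "N \<in> bounded_ops" "N \<noteq> 0"
  shows "approx_null (\<lambda>x. norm (blinfun_apply ((adj N o\<^sub>L N) - (norm N)\<^sup>2 *\<^sub>R id_blinfun) x))"
  unfolding approx_null_def
proof (intro allI impI)
  fix e :: real assume e: "e > 0"
  let ?n = "norm N"
  have n: "?n > 0" using N by simp
  \<comment> \<open>The squared residual will be at most \<open>4 * ?n ^ 3 * \<eta>\<close>, which
    this choice keeps below \<open>e\<^sup>2\<close>; \<eta> \<le> \<open>?n\<close> allows squaring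
    the lower bound on \<open>norm (N x)\<close>.\<close>
  define \<eta> where "\<eta> = min ?n (e\<^sup>2 / (8 * ?n ^ 3))"
  have \<eta>: "0 < \<eta>" "\<eta> \<le> ?n" "8 * ?n ^ 3 * \<eta> \<le> e\<^sup>2"
    using n e by (auto simp: \<eta>_def min_def field_simps)
  obtain x where x: "norm x = 1" "?n - \<eta> < norm (blinfun_apply N x)"
    using exists_unit_vector_near_norm[of "?n - \<eta>" N] \<eta> by auto
  let ?y = "blinfun_apply N x"
  have "(?n - \<eta>)\<^sup>2 \<le> (norm ?y)\<^sup>2" using x(2) \<eta> by (intro power_mono) auto
  then have lower: "?n\<^sup>2 - 2 * ?n * \<eta> \<le> (norm ?y)\<^sup>2"
    using zero_le_power2[of \<eta>] unfolding power2_diff by linarith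
  have "norm (blinfun_apply (adj N) ?y) \<le> norm (adj N) * norm ?y" by (rule norm_blinfun)
  also have "\<dots> \<le> ?n * (?n * norm x)"
    by (intro mult_mono norm_adj_le N norm_blinfun) auto
  finally have "norm (blinfun_apply (adj N) ?y) \<le> ?n\<^sup>2" by (simp add: x power2_eq_square)
  then have upper: "(norm (blinfun_apply (adj N) ?y))\<^sup>2 \<le> (?n\<^sup>2)\<^sup>2" by (intro power_mono) auto
  have "(norm (blinfun_apply (adj N) ?y - ?n\<^sup>2 *\<^sub>R x))\<^sup>2
      = (norm (blinfun_apply (adj N) ?y))\<^sup>2 - 2 * ?n\<^sup>2 * (norm ?y)\<^sup>2 + (?n\<^sup>2)\<^sup>2"
    by (simp add: norm_diff_sq cinner_scaleR_right cinner_adj'[OF N(1)] x power_mult_distrib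
        flip: norm_sq_cinner)
  also have "\<dots> \<le> 2 * (?n\<^sup>2)\<^sup>2 - 2 * ?n\<^sup>2 * (?n\<^sup>2 - 2 * ?n * \<eta>)"
    using upper mult_left_mono[OF lower, of "2 * ?n\<^sup>2"] by simp
  also have "\<dots> = (8 * ?n ^ 3 * \<eta>) / 2"
    by (simp add: power2_eq_square power3_eq_cube algebra_simps)
  also have "\<dots> \<le> e\<^sup>2 / 2" by (rule divide_right_mono[OF \<eta>(3)]) simp
  also have "\<dots> < e\<^sup>2" using e by simp
  finally have "(norm (blinfun_apply (adj N) ?y - ?n\<^sup>2 *\<^sub>R x))\<^sup>2 < e\<^sup>2" .
  then have "norm (blinfun_apply (adj N) ?y - ?n\<^sup>2 *\<^sub>R x) < e"
    by (rule power2_less_imp_less) (use e in simp)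
  then show "\<exists>x. norm x = 1 \<and>
      norm (blinfun_apply ((adj N o\<^sub>L N) - ?n\<^sup>2 *\<^sub>R id_blinfun) x) < e"
    using x(1) by (intro exI[of _ x]) (simp add: blinfun.diff_left blinfun.scaleR_left)
qed

text \<open>The sequence itself is returned, not just a point of the joint spectrum, so that limits
  of such points can be taken later.\<close>

lemma norm_attained_at_joint_eigenvalue:
  fixes A B :: "'a::complex_hilbert \<Rightarrow>\<^sub>L 'a"
  assumes A: "A \<in> bounded_ops" "normal_op A" and B: "B \<in> bounded_ops" "symmetric_op B"
    and AB: "A o\<^sub>L B = B o\<^sub>L A" and nz: "a *\<^sub>C A + b *\<^sub>C B \<noteq> 0"
  shows "\<exists>x \<zeta> t. (\<forall>n. norm (x n) = 1) \<and> star_limit_eigenvalue x A \<zeta> \<and>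
    star_limit_eigenvalue x B (complex_of_real t) \<and>
    cmod (a * \<zeta> + b * of_real t) = norm (a *\<^sub>C A + b *\<^sub>C B)"
proof -
  define N where "N = a *\<^sub>C A + b *\<^sub>C B"
  define M where "M = (adj N o\<^sub>L N) - (norm N)\<^sup>2 *\<^sub>R id_blinfun"
  \<comment> \<open>\<open>C\<close> and \<open>D\<close> are twice the real part and minus twice
    the imaginary part of \<open>A\<close>. They are symmetric, commute by normality, and recover
    both \<open>A\<close> and its adjoint linearly.\<close>
  define C where "C = A + adj A"
  define D where "D = \<i> *\<^sub>C (A - adj A)"
  note A' = adj_in_bounded_ops[OF A(1)]
  have adjB: "adj B = B" by (rule adj_eqI) (rule symmetric_opD[OF B(2)])
  have N: "N \<in> bounded_ops" by (simp add: N_def A B bounded_ops_add bounded_ops_scaleC)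
  have adjN: "adj N = cnj a *\<^sub>C adj A + cnj b *\<^sub>C B"
    by (simp add: N_def adj_add adj_scaleC A B adjB bounded_ops_scaleC)
  have c1: "blinfun_apply (adj A) (blinfun_apply A x) = blinfun_apply A (blinfun_apply (adj A) x)" for x
    using A(2) unfolding normal_op_def by (metis blinfun_apply_blinfun_compose)
  have c2: "blinfun_apply B (blinfun_apply A x) = blinfun_apply A (blinfun_apply B x)" for x
    using AB by (metis blinfun_apply_blinfun_compose)
  have "adj A o\<^sub>L B = B o\<^sub>L adj A"
    using adj_compose[OF A(1) B(1)] adj_compose[OF B(1) A(1)] AB adjB by metis
  then have c3: "blinfun_apply B (blinfun_apply (adj A) x) = blinfun_apply (adj A) (blinfun_apply B x)" for x
    by (metis blinfun_apply_blinfun_compose)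
  note simps = blinfun.add_left blinfun.diff_left scaleC_blinfun.rep_eq blinfun.add_right
    blinfun.diff_right bounded_opsD[OF A(1)] bounded_opsD[OF B(1)] bounded_opsD[OF A'] c1 c2 c3
    scaleC_add_right complex_vector.scale_right_diff_distrib scaleC_scaleC
    blinfun.scaleR_left scaleR_scaleC
  let ?F = "{C, D, B}"
  have "symmetric_op C" "symmetric_op D"
    by (simp_all add: C_def D_def symmetric_op_def simps cinner_simps cinner_adj[OF A(1)]
        cinner_adj'[OF A(1)])
  then have sym: "symmetric_op E" if "E \<in> ?F" for E
    using that B(2) by auto
  have "C o\<^sub>L D = D o\<^sub>L C" "C o\<^sub>L B = B o\<^sub>L C" "D o\<^sub>L B = B o\<^sub>L D"
    by (auto intro!: blinfun_eqI simp: C_def D_def simps algebra_simps)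
  then have comm: "E o\<^sub>L E' = E' o\<^sub>L E" if "E \<in> ?F" "E' \<in> ?F" for E E'
    using that by auto
  have "blinfun_apply M (blinfun_apply C x) = blinfun_apply C (blinfun_apply M x)"
    "blinfun_apply M (blinfun_apply D x) = blinfun_apply D (blinfun_apply M x)"
    "blinfun_apply M (blinfun_apply B x) = blinfun_apply B (blinfun_apply M x)" for x
    by (simp_all add: C_def D_def M_def adjN simps algebra_simps)
      (simp_all add: N_def simps algebra_simps)
  then have M_comm: "blinfun_apply M (blinfun_apply E x) = blinfun_apply E (blinfun_apply M x)"
    if "E \<in> ?F" for E x
    using that by auto
  \<comment> \<open>\<open>M\<close> is built from \<open>A\<close>, \<open>adj A\<close>,
    \<open>B\<close> and the identity, so it commutes with \<open>E\<close>, and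
    \<open>norm E\<close> serves as the invariance constant.\<close>
  have inv: "norm (blinfun_apply M (blinfun_apply E x)) \<le> norm E * norm (blinfun_apply M x)"
    if "E \<in> ?F" for E x
    unfolding M_comm[OF that] by (rule norm_blinfun)
  obtain m where m: "approx_null (\<lambda>x. norm (blinfun_apply M x)
      + (\<Sum>E\<in>?F. norm (blinfun_apply E x - m E *\<^sub>R x)))"
    using joint_approx_eigenvector[of ?F "\<lambda>x. norm (blinfun_apply M x)" norm,
        OF _ seminorm_fn_norm_blinfun approx_null_norm_attained[OF N, folded M_def] sym inv comm]
      nz by (auto simp: N_def)
  define p where "p x = norm (blinfun_apply M x)
      + (\<Sum>E\<in>?F. norm (blinfun_apply E x - m E *\<^sub>R x))" for x
  have "\<exists>x. norm x = 1 \<and> p x < inverse (real (Suc n))" for n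
    using m[folded p_def] unfolding approx_null_def by simp
  then obtain x where x: "\<And>n. norm (x n) = 1" and "\<And>n. p (x n) < inverse (real (Suc n))"
    by metis
  note lt = this(2)[unfolded p_def]
  have null: "u \<longlonglongrightarrow> 0" if "\<And>n. norm (u n) \<le> inverse (real (Suc n))" for u :: "nat \<Rightarrow> 'a"
    using LIMSEQ_inverse_real_of_nat by (rule Lim_null_comparison[rotated]) (use that in simp)
  have ev: "limit_eigenvalue x E (of_real (m E))" if "E \<in> ?F" for E
    unfolding limit_eigenvalue_def
  proof (rule null)
    fix n
    have "norm (blinfun_apply E (x n) - m E *\<^sub>R x n)
        \<le> (\<Sum>E\<in>?F. norm (blinfun_apply E (x n) - m E *\<^sub>R x n))"
      using that by (intro member_le_sum) auto
    then show "norm (blinfun_apply E (x n) - complex_of_real (m E) *\<^sub>C x n) \<le> inverse (real (Suc n))"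
      using lt[of n] norm_ge_zero[of "blinfun_apply M (x n)"] unfolding scaleR_scaleC by linarith
  qed
  have evM: "limit_eigenvalue x M 0"
    unfolding limit_eigenvalue_def
  proof (rule null)
    fix n
    have "0 \<le> (\<Sum>E\<in>?F. norm (blinfun_apply E (x n) - m E *\<^sub>R x n))" by (intro sum_nonneg) simp
    with lt[of n] have "norm (blinfun_apply M (x n)) \<le> inverse (real (Suc n))" by linarith
    then show "norm (blinfun_apply M (x n) - 0 *\<^sub>C x n) \<le> inverse (real (Suc n))" by simp
  qed
  \<comment> \<open>Read off from \<open>A = C / 2 - \<i> D / 2\<close>; as both eigenvalues are
    real, the adjoint gets the conjugate value.\<close>
  define \<zeta> where "\<zeta> = Complex (m C / 2) (- m D / 2)"
  have A_eq: "A = (1/2) *\<^sub>C C + (- \<i>/2) *\<^sub>C D" and A'_eq: "adj A = (1/2) *\<^sub>C C + (\<i>/2) *\<^sub>C D"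
    by (auto intro!: blinfun_eqI simp: C_def D_def simps simp flip: scaleC_add_left)
  have evC: "limit_eigenvalue x C (of_real (m C))" and evD: "limit_eigenvalue x D (of_real (m D))"
    and evB: "limit_eigenvalue x B (of_real (m B))" using ev by simp_all
  have "limit_eigenvalue x A ((1/2) * of_real (m C) + (- \<i>/2) * of_real (m D))"
    by (subst A_eq) (intro limit_eigenvalue_add limit_eigenvalue_scaleC evC evD)
  moreover have "(1/2) * of_real (m C) + (- \<i>/2) * of_real (m D) = \<zeta>"
    by (simp add: \<zeta>_def complex_eq_iff)
  ultimately have evA: "limit_eigenvalue x A \<zeta>" by simp
  have "limit_eigenvalue x (adj A) ((1/2) * of_real (m C) + (\<i>/2) * of_real (m D))"
    by (subst A'_eq) (intro limit_eigenvalue_add limit_eigenvalue_scaleC evC evD)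
  moreover have "(1/2) * of_real (m C) + (\<i>/2) * of_real (m D) = cnj \<zeta>"
    by (simp add: \<zeta>_def complex_eq_iff)
  ultimately have sevA: "star_limit_eigenvalue x A \<zeta>"
    using evA by (simp add: star_limit_eigenvalue_def)
  have sevB: "star_limit_eigenvalue x B (of_real (m B))"
    using evB by (simp add: star_limit_eigenvalue_def adjB)
  let ?l = "a * \<zeta> + b * of_real (m B)"
  have "star_limit_eigenvalue x N ?l"
    unfolding N_def using sevA sevB A B
    by (intro star_limit_eigenvalue_add star_limit_eigenvalue_scaleC bounded_ops_scaleC)
  \<comment> \<open>\<open>N\<^sup>* N\<close> has limit eigenvalue \<open>(cmod ?l)\<^sup>2\<close>
    while \<open>M\<close> has 0, which forces \<open>cmod ?l = norm N\<close>.\<close>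
  then have "limit_eigenvalue x (adj N o\<^sub>L N) (cnj ?l * ?l)"
    by (intro limit_eigenvalue_compose adj_in_bounded_ops N) (simp_all add: star_limit_eigenvalue_def)
  moreover have "limit_eigenvalue x ((norm N)\<^sup>2 *\<^sub>R id_blinfun) (of_real ((norm N)\<^sup>2))"
    by (simp add: limit_eigenvalue_def scaleR_scaleC scaleC_blinfun.rep_eq)
  ultimately have "limit_eigenvalue x M (cnj ?l * ?l - of_real ((norm N)\<^sup>2))"
    unfolding M_def by (rule limit_eigenvalue_diff)
  from limit_eigenvalue_unique[of x, OF x this evM]
  have "complex_of_real ((cmod ?l)\<^sup>2) = of_real ((norm N)\<^sup>2)"
    by (simp only: complex_norm_square) (simp add: mult.commute)
  then have "(cmod ?l)\<^sup>2 = (norm N)\<^sup>2" by (simp only: of_real_eq_iff)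
  then have "cmod ?l = norm N" by simp
  then show ?thesis using x sevA sevB unfolding N_def by blast
qed

text \<open>Diagonal argument: from the \<open>k\<close>-th sequence pick one vector whose four
  residuals, for \<open>A\<close>, \<open>B\<close> and their adjoints, are all below
  \<open>1 / (k + 1)\<close>.\<close>

lemma star_limit_eigenvalues_closed:
  assumes x: "\<And>k n. norm (x k n) = 1"
    and A: "\<And>k. star_limit_eigenvalue (x k) A (\<zeta> k)" "\<zeta> \<longlonglongrightarrow> \<zeta>'"
    and B: "\<And>k. star_limit_eigenvalue (x k) B (\<eta> k)" "\<eta> \<longlonglongrightarrow> \<eta>'"
  shows "\<exists>y. (\<forall>n. norm (y n) = 1) \<and> star_limit_eigenvalue y A \<zeta>' \<and> star_limit_eigenvalue y B \<eta>'"
proof -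
  define near where "near X c k n \<longleftrightarrow>
    norm (blinfun_apply X (x k n) - c *\<^sub>C x k n) < inverse (real (Suc k))" for X c k n
  have ev: "eventually (near X c k) sequentially" if "limit_eigenvalue (x k) X c" for X c k
    using order_tendstoD(2)[OF tendsto_norm[OF that[unfolded limit_eigenvalue_def]],
        of "inverse (real (Suc k))"]
    by (simp add: near_def[abs_def])
  have "\<exists>n. near A (\<zeta> k) k n \<and> near (adj A) (cnj (\<zeta> k)) k n \<and>
      near B (\<eta> k) k n \<and> near (adj B) (cnj (\<eta> k)) k n" for k
    by (rule eventually_happens'[OF sequentially_bot])
      (use A(1)[of k] B(1)[of k] in \<open>auto simp: star_limit_eigenvalue_def intro!: eventually_conj ev\<close>)
  then obtain i where i: "\<And>k. near A (\<zeta> k) k (i k)" "\<And>k. near (adj A) (cnj (\<zeta> k)) k (i k)"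
      "\<And>k. near B (\<eta> k) k (i k)" "\<And>k. near (adj B) (cnj (\<eta> k)) k (i k)"
    by metis
  define y where "y k = x k (i k)" for k
  have lim: "limit_eigenvalue y X d"
    if lt: "\<And>k. norm (blinfun_apply X (y k) - c k *\<^sub>C y k) < inverse (real (Suc k))" and c: "c \<longlonglongrightarrow> d"
    for X c d
    unfolding limit_eigenvalue_def
  proof (rule Lim_null_comparison)
    have "norm (blinfun_apply X (y k) - d *\<^sub>C y k) \<le> inverse (real (Suc k)) + cmod (c k - d)" for k
    proof -
      have "blinfun_apply X (y k) - d *\<^sub>C y k
          = (blinfun_apply X (y k) - c k *\<^sub>C y k) + (c k - d) *\<^sub>C y k"
        by (simp add: complex_vector.scale_left_diff_distrib)
      then have "norm (blinfun_apply X (y k) - d *\<^sub>C y k)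
          \<le> norm (blinfun_apply X (y k) - c k *\<^sub>C y k) + norm ((c k - d) *\<^sub>C y k)"
        using norm_triangle_ineq by metis
      then show ?thesis using lt[of k] by (simp add: norm_scaleC x y_def)
    qed
    then show "\<forall>\<^sub>F k in sequentially. norm (blinfun_apply X (y k) - d *\<^sub>C y k)
        \<le> inverse (real (Suc k)) + cmod (c k - d)" by simp
    show "(\<lambda>k. inverse (real (Suc k)) + cmod (c k - d)) \<longlonglongrightarrow> 0"
      using tendsto_add[OF LIMSEQ_inverse_real_of_nat tendsto_norm[OF LIM_zero[OF c]]] by simp
  qed
  show ?thesis
  proof (intro exI conjI allI)
    show "norm (y n) = 1" for n by (simp add: y_def x)
    show "star_limit_eigenvalue y A \<zeta>'" "star_limit_eigenvalue y B \<eta>'"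
      unfolding star_limit_eigenvalue_def
      by (intro conjI lim[OF i(1)[unfolded near_def, folded y_def] A(2)] lim[OF i(3)[unfolded near_def, folded y_def] B(2)]
          lim[OF i(2)[unfolded near_def, folded y_def] tendsto_cnj[OF A(2)]]
          lim[OF i(4)[unfolded near_def, folded y_def] tendsto_cnj[OF B(2)]])+
  qed
qed

lemma cauchy_schwarz_pair:
  "cmod (a * \<zeta> + b * of_real t) \<le> sqrt ((cmod a)\<^sup>2 + (cmod b)\<^sup>2) * sqrt ((cmod \<zeta>)\<^sup>2 + t\<^sup>2)"
proof -
  have "cmod (cinner (\<zeta>, complex_of_real t) (cnj a, cnj b))
      \<le> norm (\<zeta>, complex_of_real t) * norm (cnj a, cnj b)"
    by (rule cmod_cinner_le)
  then show ?thesis by (simp add: cinner_prod_def cinner_complex_def norm_prod_def mult.commute)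
qed

lemma pythagoras_orthogonal_unit_iff:
  assumes "norm x = 1" "norm y = 1"
  shows "x \<bottom>\<^sub>P y \<longleftrightarrow> (\<forall>a b. norm (a *\<^sub>C x + b *\<^sub>C y) = sqrt ((cmod a)\<^sup>2 + (cmod b)\<^sup>2))"
proof -
  have "u\<^sup>2 = v \<longleftrightarrow> u = sqrt v" if "u \<ge> 0" "v \<ge> 0" for u v :: real
    using that by (metis real_sqrt_pow2 real_sqrt_unique)
  then show ?thesis by (simp add: pythagoras_orthogonal_iff assms)
qed

theorem proposition3p1:
  fixes A B :: "'a::complex_hilbert \<Rightarrow>\<^sub>L 'a"
  assumes "A \<in> bounded_ops" and "B \<in> bounded_ops"
    and "normal_op A" and "normal_op B"
    and "A o\<^sub>L B = B o\<^sub>L A"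
    and "norm A = 1" and "norm B = 1"
    and "positive_op B"
  shows "A \<bottom>\<^sub>P B \<longleftrightarrow> joint_spectrum A B \<subseteq> half_ball \<and> hemisphere \<subseteq> joint_spectrum A B"
proof -
  let ?S = "generated_cstar_algebra {A, B}"
  have S: "cstar_subalgebra ?S" by (rule cstar_subalgebra_generated) (use assms in simp)
  have AB: "A \<in> ?S" "B \<in> ?S" using generated_cstar_algebra_superset[of "{A, B}"] by auto
  have char_le: "cmod (a * \<zeta> + b * \<eta>) \<le> norm (a *\<^sub>C A + b *\<^sub>C B)" and char_nonneg: "\<eta> \<in> \<real>\<^sub>\<ge>\<^sub>0"
    if mem: "(\<zeta>, \<eta>) \<in> joint_spectrum A B" for \<zeta> \<eta> a b
  proof -
    obtain \<omega> where \<omega>: "\<omega> \<in> characters_on ?S" "\<omega> A = \<zeta>" "\<omega> B = \<eta>"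
      using mem by (auto simp: joint_spectrum_def)
    have in_S: "a *\<^sub>C A \<in> ?S" "b *\<^sub>C B \<in> ?S" "a *\<^sub>C A + b *\<^sub>C B \<in> ?S"
      using S AB by (auto simp: cstar_subalgebra_def)
    then have "\<omega> (a *\<^sub>C A + b *\<^sub>C B) = a * \<zeta> + b * \<eta>"
      using \<omega> AB by (simp add: characters_on_def)
    then show "cmod (a * \<zeta> + b * \<eta>) \<le> norm (a *\<^sub>C A + b *\<^sub>C B)"
      using character_bound[OF S \<omega>(1) in_S(3)] by simp
    show "\<eta> \<in> \<real>\<^sub>\<ge>\<^sub>0" using character_positive_op[OF S \<omega>(1) AB(2) assms(8)] \<omega>(3) by simp
  qed
  have attained: "\<exists>x \<zeta> t. (\<forall>n. norm (x n) = 1) \<and> star_limit_eigenvalue x A \<zeta> \<and>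
      star_limit_eigenvalue x B (complex_of_real t) \<and>
      cmod (a * \<zeta> + b * of_real t) = norm (a *\<^sub>C A + b *\<^sub>C B) \<and>
      (\<zeta>, of_real t) \<in> joint_spectrum A B"
    if nz: "a *\<^sub>C A + b *\<^sub>C B \<noteq> 0" for a b
  proof -
    obtain x \<zeta> t where *: "\<And>n. norm (x n) = 1" "star_limit_eigenvalue x A \<zeta>"
        "star_limit_eigenvalue x B (complex_of_real t)"
        "cmod (a * \<zeta> + b * of_real t) = norm (a *\<^sub>C A + b *\<^sub>C B)"
      using norm_attained_at_joint_eigenvalue[OF assms(1,3,2) positive_op_symmetric[OF assms(2,8)]
          assms(5) nz] by blast
    \<comment> \<open>At \<open>(0, 0)\<close> the combination would vanish, but its modulus is a
      nonzero norm.\<close>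
    moreover have "(\<zeta>, complex_of_real t) \<noteq> (0, 0)" using *(4) nz by auto
    then have "(\<zeta>, complex_of_real t) \<in> joint_spectrum A B"
      using star_limit_eigenvalues_in_joint_spectrum[OF assms(1,2) *(1-3)] by blast
    ultimately show ?thesis by blast
  qed
  note unit_iff = pythagoras_orthogonal_unit_iff[OF assms(6,7)]
  show ?thesis
  proof (intro iffI conjI)
    assume "A \<bottom>\<^sub>P B"
    then have P: "norm (a *\<^sub>C A + b *\<^sub>C B) = sqrt ((cmod a)\<^sup>2 + (cmod b)\<^sup>2)" for a b
      using unit_iff by blast
    show half: "joint_spectrum A B \<subseteq> half_ball"
    proof (clarify)
      fix \<zeta> \<eta> assume mem: "(\<zeta>, \<eta>) \<in> joint_spectrum A B"
      obtain t where t: "\<eta> = of_real t" "t \<ge> 0"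
        using char_nonneg[OF mem] by (auto elim: nonneg_Reals_cases)
      let ?s = "(cmod \<zeta>)\<^sup>2 + t\<^sup>2"
      \<comment> \<open>Testing with \<open>a = cnj \<zeta>\<close> and \<open>b = t\<close> turns
        contractivity into \<open>?s \<le> sqrt ?s\<close>, which excludes
        \<open>?s > 1\<close>.\<close>
      have "cnj \<zeta> * \<zeta> + of_real t * \<eta> = complex_of_real ?s"
        by (simp add: t power2_eq_square mult.commute flip: complex_norm_square)
      then have le: "\<bar>?s\<bar> \<le> sqrt ?s"
        using char_le[OF mem, of "cnj \<zeta>" "of_real t"] unfolding P by (simp only: norm_of_real) simp
      have "?s \<le> 1"
      proof (rule ccontr)
        assume "\<not> ?s \<le> 1"
        then have "sqrt ?s < ?s" by (intro real_less_lsqrt) (auto simp: power2_eq_square[of ?s])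
        with le show False by linarith
      qed
      then show "(\<zeta>, \<eta>) \<in> half_ball" using t by (auto simp: half_ball_def)
    qed
    have interior: "\<exists>x. (\<forall>n. norm (x n) = 1) \<and> star_limit_eigenvalue x A \<zeta> \<and>
        star_limit_eigenvalue x B (complex_of_real t)"
      if \<zeta>t: "(cmod \<zeta>)\<^sup>2 + t\<^sup>2 = 1" "t > 0" for \<zeta> t
    proof -
      have n1: "norm (cnj \<zeta> *\<^sub>C A + complex_of_real t *\<^sub>C B) = 1" using \<zeta>t by (simp add: P)
      then have "cnj \<zeta> *\<^sub>C A + complex_of_real t *\<^sub>C B \<noteq> 0" by auto
      from attained[OF this] obtain x \<xi> s where x: "\<And>n. norm (x n) = 1" "star_limit_eigenvalue x A \<xi>"
          "star_limit_eigenvalue x B (complex_of_real s)"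
        and eq: "cmod (cnj \<zeta> * \<xi> + of_real t * of_real s) = 1"
        and mem: "(\<xi>, complex_of_real s) \<in> joint_spectrum A B" unfolding n1 by blast
      have s: "(cmod \<xi>)\<^sup>2 + s\<^sup>2 \<le> 1" "0 \<le> s" using half mem by (auto simp: half_ball_def)
      define z where "z = cnj \<zeta> * \<xi> + of_real t * of_real s"
      let ?u = "(\<xi>, complex_of_real s)" and ?v = "(\<zeta>, complex_of_real t)"
      have uv: "cinner ?u ?v = z" by (simp add: z_def cinner_prod_def cinner_complex_def mult.commute)
      have "(norm ?v)\<^sup>2 = 1" "(norm ?u)\<^sup>2 \<le> 1" using \<zeta>t s by (simp_all add: norm_prod_def)
      \<comment> \<open>Equality in Cauchy-Schwarz: \<open>cmod z = 1\<close> and \<open>?v\<close>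
        is a unit vector, so \<open>?u\<close>, of norm at most 1, has no component orthogonal to
        \<open>?v\<close>.\<close>
      then have "(norm (?u - z *\<^sub>C ?v))\<^sup>2 \<le> 0"
        using norm_diff_projection_sq[of ?u ?v] eq unfolding uv by (simp add: z_def)
      then have "?u = z *\<^sub>C ?v" by simp
      then have zs: "\<xi> = z * \<zeta>" "complex_of_real s = z * of_real t"
        by (simp_all add: scaleC_prod_def scaleC_complex_def)
      \<comment> \<open>The second coordinates are real with \<open>t > 0\<close> and
        \<open>s \<ge> 0\<close>, so the unimodular factor \<open>z\<close> is nonnegative and
        equals 1.\<close>
      then have "z = of_real (s / t)" using \<zeta>t(2) by (simp add: field_simps)
      moreover from this have "cmod z = s / t" using s(2) \<zeta>t(2) by (simp only: norm_of_real) simp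
      ultimately have "z = 1" using eq by (simp add: z_def)
      then show ?thesis using zs x by auto
    qed
    show "hemisphere \<subseteq> joint_spectrum A B"
    proof (clarsimp simp: hemisphere_def)
      fix \<zeta> and t :: real assume \<zeta>t: "(cmod \<zeta>)\<^sup>2 + t\<^sup>2 = 1" "0 \<le> t"
      have "\<exists>x. (\<forall>n. norm (x n) = 1) \<and> star_limit_eigenvalue x A \<zeta> \<and>
          star_limit_eigenvalue x B (complex_of_real t)"
      proof (cases "t = 0")
        case False
        then show ?thesis using interior \<zeta>t by simp
      next
        case True
        \<comment> \<open>Approach the boundary circle from the open hemisphere: at height \<tau>,
          shrinking \<zeta> by \<open>sqrt (1 - \<tau>\<^sup>2)\<close> keeps the point on the
          sphere.\<close>
        define \<tau> where "\<tau> k = inverse (real (Suc k))" for k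
        define \<xi> where "\<xi> k = of_real (sqrt (1 - (\<tau> k)\<^sup>2)) * \<zeta>" for k
        have \<tau>: "0 < \<tau> k" "\<tau> k \<le> 1" for k by (simp_all add: \<tau>_def inverse_le_1_iff)
        have "(cmod (\<xi> k))\<^sup>2 + (\<tau> k)\<^sup>2 = 1" for k
        proof -
          have "(\<tau> k)\<^sup>2 \<le> 1" using \<tau>[of k] by (simp add: power_le_one)
          then show ?thesis using \<zeta>t True by (simp add: \<xi>_def norm_mult power_mult_distrib)
        qed
        then have "\<forall>k. \<exists>x. (\<forall>n. norm (x n) = 1) \<and> star_limit_eigenvalue x A (\<xi> k) \<and>
            star_limit_eigenvalue x B (complex_of_real (\<tau> k))"
          using interior \<tau> by blast
        then obtain x where x: "\<And>k n. norm (x k n) = 1"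
            "\<And>k. star_limit_eigenvalue (x k) A (\<xi> k)"
            "\<And>k. star_limit_eigenvalue (x k) B (complex_of_real (\<tau> k))"
          by metis
        have lim: "\<tau> \<longlonglongrightarrow> 0" unfolding \<tau>_def by (rule LIMSEQ_inverse_real_of_nat)
        have "\<xi> \<longlonglongrightarrow> of_real (sqrt (1 - 0\<^sup>2)) * \<zeta>"
          unfolding \<xi>_def by (intro tendsto_intros lim)
        then have "\<xi> \<longlonglongrightarrow> \<zeta>" by simp
        moreover have "(\<lambda>k. complex_of_real (\<tau> k)) \<longlonglongrightarrow> of_real t"
          using tendsto_of_real[OF lim] True by simp
        ultimately show ?thesis using star_limit_eigenvalues_closed[of x, OF x(1,2) _ x(3)] by blast
      qed
      moreover have "(\<zeta>, complex_of_real t) \<noteq> (0, 0)" using \<zeta>t by auto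
      ultimately show "(\<zeta>, complex_of_real t) \<in> joint_spectrum A B"
        using star_limit_eigenvalues_in_joint_spectrum[OF assms(1,2)] by blast
    qed
  next
    assume "joint_spectrum A B \<subseteq> half_ball \<and> hemisphere \<subseteq> joint_spectrum A B"
    then have half: "joint_spectrum A B \<subseteq> half_ball" and hemi: "hemisphere \<subseteq> joint_spectrum A B" by auto
    show "A \<bottom>\<^sub>P B" unfolding unit_iff
    proof (intro allI antisym)
      fix a b :: complex
      let ?r = "sqrt ((cmod a)\<^sup>2 + (cmod b)\<^sup>2)"
      show "norm (a *\<^sub>C A + b *\<^sub>C B) \<le> ?r"
      proof (cases "a *\<^sub>C A + b *\<^sub>C B = 0")
        case False
        from attained[OF this] obtain \<zeta> t
          where eq: "cmod (a * \<zeta> + b * of_real t) = norm (a *\<^sub>C A + b *\<^sub>C B)"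
            and "(\<zeta>, complex_of_real t) \<in> joint_spectrum A B" by blast
        \<comment> \<open>The norm is attained at a point of the half-ball, where Cauchy-Schwarz
          bounds the value by \<open>?r\<close>.\<close>
        then have "sqrt ((cmod \<zeta>)\<^sup>2 + t\<^sup>2) \<le> 1" using half by (auto simp: half_ball_def)
        then have "?r * sqrt ((cmod \<zeta>)\<^sup>2 + t\<^sup>2) \<le> ?r * 1" by (intro mult_left_mono) auto
        then show ?thesis using cauchy_schwarz_pair[of a \<zeta> b t] eq by simp
      qed simp
      show "?r \<le> norm (a *\<^sub>C A + b *\<^sub>C B)"
      proof (cases "?r = 0")
        case False
        then have r: "?r > 0" by (simp add: less_le)
        \<comment> \<open>The normalised conjugate of \<open>(a, b)\<close> gives the value
          \<open>?r\<close>, but its second coordinate may not be real. Multiplying by the phase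
          \<theta> of \<open>b\<close> makes that coordinate nonnegative without changing the
          modulus of the value; for \<open>b = 0\<close> any phase would do.\<close>
        define \<theta> where "\<theta> = (if b = 0 then 1 else b / of_real (cmod b))"
        have \<theta>: "cmod \<theta> = 1" "\<theta> * cnj b = of_real (cmod b)"
          by (auto simp: \<theta>_def norm_divide power2_eq_square simp flip: complex_norm_square)
        define \<zeta> where "\<zeta> = \<theta> * cnj a / of_real ?r"
        define t where "t = cmod b / ?r"
        have r2: "?r\<^sup>2 = (cmod a)\<^sup>2 + (cmod b)\<^sup>2" by simp
        have "(cmod \<zeta>)\<^sup>2 = (cmod a)\<^sup>2 / ?r\<^sup>2" "t\<^sup>2 = (cmod b)\<^sup>2 / ?r\<^sup>2"
          by (simp_all add: \<zeta>_def t_def norm_mult norm_divide \<theta> power_divide)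
        then have "(cmod \<zeta>)\<^sup>2 + t\<^sup>2 = ?r\<^sup>2 / ?r\<^sup>2"
          unfolding r2 by (simp only: add_divide_distrib)
        also have "\<dots> = 1" by (rule divide_self) (use r in auto)
        finally have "(cmod \<zeta>)\<^sup>2 + t\<^sup>2 = 1" .
        moreover have "0 \<le> t" using r by (simp add: t_def)
        ultimately have "(\<zeta>, complex_of_real t) \<in> joint_spectrum A B"
          using hemi unfolding hemisphere_def by blast
        moreover have "a * \<zeta> + b * of_real t = \<theta> * of_real ?r"
        proof -
          have "a * \<zeta> + b * of_real t = \<theta> * (a * cnj a + b * cnj b) / of_real ?r"
            by (simp add: \<zeta>_def t_def add_divide_distrib algebra_simps flip: \<theta>(2))
          also have "a * cnj a + b * cnj b = of_real (?r\<^sup>2)"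
            unfolding r2 by (simp only: of_real_add complex_norm_square)
          also have "\<theta> * of_real (?r\<^sup>2) / of_real ?r = \<theta> * of_real ?r"
          proof -
            have "\<theta> * of_real (u\<^sup>2) / of_real u = \<theta> * of_real u" if "u > 0" for u :: real
              using that by (simp add: power2_eq_square)
            then show ?thesis using r .
          qed
          finally show ?thesis .
        qed
        ultimately have "cmod (\<theta> * of_real ?r) \<le> norm (a *\<^sub>C A + b *\<^sub>C B)" using char_le by metis
        then show ?thesis using r by (simp add: norm_mult \<theta>)
      qed simp
    qed
  qed
qed

end
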